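(* Let $\mathfrak n_{m,s}$ be the free $s$-step nilpotent real Lie algebra on $m\ge 2$ generators. The following are equivalent: \begin{enumerate} \item $\mathfrak n_{m,s}$ is nonnice; \item $T^*\mathfrak n_{m,s}$ is nonnice; \item either $m=2$ and $s\geq 5$, or $m\geq 3$ and $s\geq 3$. \end{enumerate}
   Context: Lie algebras are real and finite-dimensional. $\mathfrak n_{m,s}$ is the quotient of the free Lie algebra on $m$ generators by the ideal of elements of degree greater than $s$ ($s\ge1$). For a Lie algebra $\mathfrak g$, the cotangent Lie algebra is the semidirect product $T^*\mathfrak g=\mathfrak g\ltimes\mathfrak g^*$, where $\mathfrak g^*$ is an abelian ideal and $[X,\alpha]=-\alpha\circ\operatorname{ad}_X$ for $X\in\mathfrak g$, $\alpha\in\mathfrak g^*$. A Lie algebra is nice if it has a nice basis, i.e. a basis $\{e_1,\dots,e_n\}$ with dual basis $\{e^1,\dots,e^n\}$ such that each $[e_i,e_j]$ is a (possibly zero) multiple of a basis element and each interior product $e_i\lrcorner\, de^j$ is a (possibly zero) multiple of an element of the dual basis, where $d$ is the Chevalley–Eilenberg differential, $de^k(X,Y)=-e^k([X,Y])$. It is nonnice if it has no nice basis. *)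

theory Defs
  imports Complex_Main "HOL-Algebra.QuotRing" "HOL-Algebra.Module"
begin

section \<open>Real algebras and Lie algebras with explicit carriers\<close>

text \<open>
  A real, not necessarily associative, algebra is a record of type \<^typ>\<open>(real, 'a) module\<close>:
  a module over the reals in the sense of \<^theory>\<open>HOL-Algebra.Module\<close>, whose field
  \<^const>\<open>mult\<close> holds the product. For a Lie algebra the product is the bracket, so that
  \<open>x \<otimes> y\<close> stands for \<open>[x, y]\<close>. The field \<^const>\<open>one\<close> of the record carries no meaning.
\<close>

definition real_ring :: "real ring" where
  "real_ring = \<lparr>carrier = UNIV, mult = (*), one = 1, zero = 0, add = (+)\<rparr>"

locale nonassoc_algebra = module real_ring A for A (structure) +
  assumes prod_closed: "\<lbrakk>x \<in> carrier A; y \<in> carrier A\<rbrakk> \<Longrightarrow> x \<otimes> y \<in> carrier A"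
    and prod_add_left: "\<lbrakk>x \<in> carrier A; y \<in> carrier A; z \<in> carrier A\<rbrakk>
      \<Longrightarrow> (x \<oplus> y) \<otimes> z = x \<otimes> z \<oplus> y \<otimes> z"
    and prod_add_right: "\<lbrakk>x \<in> carrier A; y \<in> carrier A; z \<in> carrier A\<rbrakk>
      \<Longrightarrow> x \<otimes> (y \<oplus> z) = x \<otimes> y \<oplus> x \<otimes> z"
    and prod_smult_left: "\<lbrakk>x \<in> carrier A; y \<in> carrier A\<rbrakk>
      \<Longrightarrow> (c \<odot> x) \<otimes> y = c \<odot> (x \<otimes> y)"
    and prod_smult_right: "\<lbrakk>x \<in> carrier A; y \<in> carrier A\<rbrakk>
      \<Longrightarrow> x \<otimes> (c \<odot> y) = c \<odot> (x \<otimes> y)"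

locale lie_algebra = nonassoc_algebra L for L (structure) +
  assumes bracket_self: "x \<in> carrier L \<Longrightarrow> x \<otimes> x = \<zero>"
    and jacobi: "\<lbrakk>x \<in> carrier L; y \<in> carrier L; z \<in> carrier L\<rbrakk>
      \<Longrightarrow> x \<otimes> (y \<otimes> z) \<oplus> y \<otimes> (z \<otimes> x) \<oplus> z \<otimes> (x \<otimes> y) = \<zero>"

definition alg_ideal :: "'a set \<Rightarrow> (real, 'a) module \<Rightarrow> bool" where
  "alg_ideal I A \<longleftrightarrow> submodule I real_ring A \<and>
     (\<forall>x\<in>carrier A. \<forall>i\<in>I. x \<otimes>\<^bsub>A\<^esub> i \<in> I \<and> i \<otimes>\<^bsub>A\<^esub> x \<in> I)"

definition gen_alg_ideal :: "(real, 'a) module \<Rightarrow> 'a set \<Rightarrow> 'a set" where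
  "gen_alg_ideal A S = \<Inter>{I. alg_ideal I A \<and> S \<subseteq> I}"

definition alg_quot :: "(real, 'a) module \<Rightarrow> 'a set \<Rightarrow> (real, 'a set) module" where
  "alg_quot A I = \<lparr>carrier = a_rcosets\<^bsub>A\<^esub> I, mult = rcoset_mult A I, one = undefined,
     zero = I, add = set_add A, smult = (\<lambda>c C. \<Union>x\<in>C. I +>\<^bsub>A\<^esub> (c \<odot>\<^bsub>A\<^esub> x))\<rparr>"


section \<open>Free Lie algebras and their nilpotent quotients\<close>

text \<open>
  The free nonassociative algebra on the generators \<open>0, \<dots>, m - 1\<close> has the nonassociative words
  (elements of the free magma) in these generators as a basis. Its elements are represented by
  their coefficient functions, which have finite support.
\<close>

datatype word = Gen nat | Br word word

fun gens :: "word \<Rightarrow> nat set" where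
  "gens (Gen i) = {i}"
| "gens (Br u v) = gens u \<union> gens v"

fun word_degree :: "word \<Rightarrow> nat" where
  "word_degree (Gen i) = 1"
| "word_degree (Br u v) = word_degree u + word_degree v"

text \<open>The product extends \<^const>\<open>Br\<close> bilinearly: \<open>Br u v\<close> arises only from the words \<open>u\<close> and \<open>v\<close>.\<close>

definition free_nonassoc :: "nat \<Rightarrow> (real, word \<Rightarrow> real) module" where
  "free_nonassoc m =
     \<lparr>carrier = {p. finite {w. p w \<noteq> 0} \<and> (\<forall>w. p w \<noteq> 0 \<longrightarrow> gens w \<subseteq> {..<m})},
      mult = (\<lambda>p q w. case w of Gen i \<Rightarrow> 0 | Br u v \<Rightarrow> p u * q v), one = undefined,
      zero = (\<lambda>w. 0), add = (\<lambda>p q w. p w + q w), smult = (\<lambda>c p w. c * p w)\<rparr>"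

definition lie_relations :: "(real, 'a) module \<Rightarrow> 'a set" where
  "lie_relations A = {x \<otimes>\<^bsub>A\<^esub> x | x. x \<in> carrier A} \<union>
     {x \<otimes>\<^bsub>A\<^esub> (y \<otimes>\<^bsub>A\<^esub> z) \<oplus>\<^bsub>A\<^esub> y \<otimes>\<^bsub>A\<^esub> (z \<otimes>\<^bsub>A\<^esub> x) \<oplus>\<^bsub>A\<^esub> z \<otimes>\<^bsub>A\<^esub> (x \<otimes>\<^bsub>A\<^esub> y) | x y z.
        x \<in> carrier A \<and> y \<in> carrier A \<and> z \<in> carrier A}"

definition lie_ideal :: "nat \<Rightarrow> (word \<Rightarrow> real) set" where
  "lie_ideal m = gen_alg_ideal (free_nonassoc m) (lie_relations (free_nonassoc m))"

definition free_lie :: "nat \<Rightarrow> (real, (word \<Rightarrow> real) set) module" where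
  "free_lie m = alg_quot (free_nonassoc m) (lie_ideal m)"

text \<open>
  The sum of the homogeneous components of degree greater than \<open>s\<close> of the free Lie algebra:
  the classes of the linear combinations of words of degree greater than \<open>s\<close>.
\<close>

definition degree_gt :: "nat \<Rightarrow> nat \<Rightarrow> (word \<Rightarrow> real) set set" where
  "degree_gt m s = {lie_ideal m +>\<^bsub>free_nonassoc m\<^esub> p | p.
     p \<in> carrier (free_nonassoc m) \<and> (\<forall>w. p w \<noteq> 0 \<longrightarrow> word_degree w > s)}"

definition free_nilpotent :: "nat \<Rightarrow> nat \<Rightarrow> (real, (word \<Rightarrow> real) set set) module" where
  "free_nilpotent m s = alg_quot (free_lie m) (degree_gt m s)"


section \<open>Dual space and cotangent Lie algebra\<close>

text \<open>Functionals are defined on the carrier only, i.e. they are \<^const>\<open>extensional\<close>.\<close>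

definition dual_space :: "(real, 'a) module \<Rightarrow> (real, 'a \<Rightarrow> real) module" where
  "dual_space L =
     \<lparr>carrier = {\<phi> \<in> extensional (carrier L).
        (\<forall>x\<in>carrier L. \<forall>y\<in>carrier L. \<phi> (x \<oplus>\<^bsub>L\<^esub> y) = \<phi> x + \<phi> y) \<and>
        (\<forall>c. \<forall>x\<in>carrier L. \<phi> (c \<odot>\<^bsub>L\<^esub> x) = c * \<phi> x)},
      mult = undefined, one = undefined, zero = (\<lambda>x\<in>carrier L. 0),
      add = (\<lambda>\<phi> \<psi>. \<lambda>x\<in>carrier L. \<phi> x + \<psi> x), smult = (\<lambda>c \<phi>. \<lambda>x\<in>carrier L. c * \<phi> x)\<rparr>"

definition coad :: "(real, 'a) module \<Rightarrow> 'a \<Rightarrow> ('a \<Rightarrow> real) \<Rightarrow> ('a \<Rightarrow> real)" where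
  "coad L x \<alpha> = (\<lambda>y\<in>carrier L. - \<alpha> (x \<otimes>\<^bsub>L\<^esub> y))"

text \<open>
  The pair \<open>(x, \<alpha>)\<close> stands for \<open>x + \<alpha>\<close>, so \<open>[x + \<alpha>, y + \<beta>] = [x, y] + [x, \<beta>] - [y, \<alpha>]\<close>.
\<close>

definition cotangent :: "(real, 'a) module \<Rightarrow> (real, 'a \<times> ('a \<Rightarrow> real)) module" where
  "cotangent L =
     \<lparr>carrier = carrier L \<times> carrier (dual_space L),
      mult = (\<lambda>(x, \<alpha>) (y, \<beta>). (x \<otimes>\<^bsub>L\<^esub> y,
        coad L x \<beta> \<oplus>\<^bsub>dual_space L\<^esub> ((-1) \<odot>\<^bsub>dual_space L\<^esub> coad L y \<alpha>))),
      one = undefined, zero = (\<zero>\<^bsub>L\<^esub>, \<zero>\<^bsub>dual_space L\<^esub>),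
      add = (\<lambda>(x, \<alpha>) (y, \<beta>). (x \<oplus>\<^bsub>L\<^esub> y, \<alpha> \<oplus>\<^bsub>dual_space L\<^esub> \<beta>)),
      smult = (\<lambda>c (x, \<alpha>). (c \<odot>\<^bsub>L\<^esub> x, c \<odot>\<^bsub>dual_space L\<^esub> \<alpha>))\<rparr>"


section \<open>Nice bases\<close>

definition lin_comb :: "(real, 'a) module \<Rightarrow> nat \<Rightarrow> (nat \<Rightarrow> 'a) \<Rightarrow> (nat \<Rightarrow> real) \<Rightarrow> 'a" where
  "lin_comb L n e c = (\<Oplus>\<^bsub>L\<^esub>i\<in>{..<n}. c i \<odot>\<^bsub>L\<^esub> e i)"

definition basis :: "(real, 'a) module \<Rightarrow> nat \<Rightarrow> (nat \<Rightarrow> 'a) \<Rightarrow> bool" where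
  "basis L n e \<longleftrightarrow> (\<forall>i<n. e i \<in> carrier L) \<and>
     (\<forall>c. lin_comb L n e c = \<zero>\<^bsub>L\<^esub> \<longrightarrow> (\<forall>i<n. c i = 0)) \<and>
     (\<forall>x\<in>carrier L. \<exists>c. x = lin_comb L n e c)"

definition dual_basis ::
    "(real, 'a) module \<Rightarrow> nat \<Rightarrow> (nat \<Rightarrow> 'a) \<Rightarrow> (nat \<Rightarrow> 'a \<Rightarrow> real) \<Rightarrow> bool" where
  "dual_basis L n e \<epsilon> \<longleftrightarrow> (\<forall>j<n. \<epsilon> j \<in> carrier (dual_space L)) \<and>
     (\<forall>i<n. \<forall>j<n. \<epsilon> j (e i) = (if i = j then 1 else 0))"

text \<open>The Chevalley--Eilenberg differential of a 1-form.\<close>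

definition ce_diff :: "(real, 'a) module \<Rightarrow> ('a \<Rightarrow> real) \<Rightarrow> ('a \<Rightarrow> 'a \<Rightarrow> real)" where
  "ce_diff L \<alpha> = (\<lambda>x\<in>carrier L. \<lambda>y\<in>carrier L. - \<alpha> (x \<otimes>\<^bsub>L\<^esub> y))"

definition interior_prod :: "'a \<Rightarrow> ('a \<Rightarrow> 'a \<Rightarrow> real) \<Rightarrow> ('a \<Rightarrow> real)" where
  "interior_prod x \<omega> = \<omega> x"

text \<open>A basis has exactly one dual basis, so it does not matter how \<open>\<epsilon>\<close> is quantified.\<close>

definition nice_basis :: "(real, 'a) module \<Rightarrow> nat \<Rightarrow> (nat \<Rightarrow> 'a) \<Rightarrow> bool" where
  "nice_basis L n e \<longleftrightarrow> basis L n e \<and>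
     (\<forall>i<n. \<forall>j<n. \<exists>k<n. \<exists>c. e i \<otimes>\<^bsub>L\<^esub> e j = c \<odot>\<^bsub>L\<^esub> e k) \<and>
     (\<exists>\<epsilon>. dual_basis L n e \<epsilon> \<and>
       (\<forall>i<n. \<forall>j<n. \<exists>k<n. \<exists>c.
          interior_prod (e i) (ce_diff L (\<epsilon> j)) = c \<odot>\<^bsub>dual_space L\<^esub> \<epsilon> k))"

definition nice :: "(real, 'a) module \<Rightarrow> bool" where
  "nice L \<longleftrightarrow> (\<exists>n e. nice_basis L n e)"

definition nonnice :: "(real, 'a) module \<Rightarrow> bool" where
  "nonnice L \<longleftrightarrow> \<not> nice L"


section \<open>The constructions yield Lie algebras\<close>

lemma real_ring_cring: "cring real_ring"
proof -
  have "\<exists>y. y + x = 0 \<and> x + y = (0::real)" for x by (rule exI[of _ "-x"]) simp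
  then show ?thesis
  by unfold_locales (auto simp: real_ring_def Units_def algebra_simps)
qed

lemma real_ring_simps [simp]: "carrier real_ring = UNIV" "mult real_ring = (*)"
  "one real_ring = 1" "zero real_ring = 0" "add real_ring = (+)"
  by (auto simp: real_ring_def)

lemma UN_eq_const: "x \<in> C \<Longrightarrow> (\<And>a. a \<in> C \<Longrightarrow> F a = G) \<Longrightarrow> (\<Union>a\<in>C. F a) = G"
  by blast

lemma quot_facts:
  assumes A: "nonassoc_algebra A" and I: "alg_ideal I A"
  shows "carrier (alg_quot A I) = (\<lambda>x. I +>\<^bsub>A\<^esub> x) ` carrier A"
    and "\<And>x y. \<lbrakk>x \<in> carrier A; y \<in> carrier A\<rbrakk> \<Longrightarrow>
       (I +>\<^bsub>A\<^esub> x) \<oplus>\<^bsub>alg_quot A I\<^esub> (I +>\<^bsub>A\<^esub> y) = I +>\<^bsub>A\<^esub> (x \<oplus>\<^bsub>A\<^esub> y)"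
    and "\<And>x y. \<lbrakk>x \<in> carrier A; y \<in> carrier A\<rbrakk> \<Longrightarrow>
       (I +>\<^bsub>A\<^esub> x) \<otimes>\<^bsub>alg_quot A I\<^esub> (I +>\<^bsub>A\<^esub> y) = I +>\<^bsub>A\<^esub> (x \<otimes>\<^bsub>A\<^esub> y)"
    and "\<And>c x. \<lbrakk>x \<in> carrier A\<rbrakk> \<Longrightarrow>
       c \<odot>\<^bsub>alg_quot A I\<^esub> (I +>\<^bsub>A\<^esub> x) = I +>\<^bsub>A\<^esub> (c \<odot>\<^bsub>A\<^esub> x)"
    and "\<zero>\<^bsub>alg_quot A I\<^esub> = I +>\<^bsub>A\<^esub> \<zero>\<^bsub>A\<^esub>"
    and "\<And>x. x \<in> carrier A \<Longrightarrow> I +>\<^bsub>A\<^esub> x = I +>\<^bsub>A\<^esub> \<zero>\<^bsub>A\<^esub> \<longleftrightarrow> x \<in> I"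
proof -
  interpret A: nonassoc_algebra A by fact
  have sub: "submodule I real_ring A" using I by (simp add: alg_ideal_def)
  then have sg: "subgroup I (add_monoid A)" by (rule submodule.axioms)
  interpret I: abelian_subgroup I A
    by (rule abelian_subgroupI3) (auto intro: additive_subgroupI sg A.abelian_group_axioms)
  have IA: "\<And>x. x \<in> I \<Longrightarrow> x \<in> carrier A" using I.a_subset by auto
  have Ism: "\<And>c x. x \<in> I \<Longrightarrow> c \<odot>\<^bsub>A\<^esub> x \<in> I" using submodule.smult_closed[OF sub] by simp
  have smc: "\<And>c x. x \<in> carrier A \<Longrightarrow> c \<odot>\<^bsub>A\<^esub> x \<in> carrier A" using A.smult_closed by simp
  have dist: "\<And>c x y. \<lbrakk>x \<in> carrier A; y \<in> carrier A\<rbrakk> \<Longrightarrow> c \<odot>\<^bsub>A\<^esub> (x \<oplus>\<^bsub>A\<^esub> y) = c \<odot>\<^bsub>A\<^esub> x \<oplus>\<^bsub>A\<^esub> c \<odot>\<^bsub>A\<^esub> y"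
    using A.smult_r_distr by simp
  have eqI: "I +>\<^bsub>A\<^esub> (i \<oplus>\<^bsub>A\<^esub> x) = I +>\<^bsub>A\<^esub> x" if "i \<in> I" "x \<in> carrier A" for i x
    using that sg A.a_rcosI[OF that(1) I.a_subset that(2)] A.a_repr_independence by metis
  have mem: "a \<in> I +>\<^bsub>A\<^esub> x \<longleftrightarrow> (\<exists>i\<in>I. a = i \<oplus>\<^bsub>A\<^esub> x)" for a x
    by (auto simp: a_r_coset_def')
  have self: "x \<in> I +>\<^bsub>A\<^esub> x" if "x \<in> carrier A" for x
    unfolding mem using that by (intro bexI[of _ "\<zero>\<^bsub>A\<^esub>"]) auto
  show "carrier (alg_quot A I) = (\<lambda>x. I +>\<^bsub>A\<^esub> x) ` carrier A"
    by (auto simp: alg_quot_def A_RCOSETS_def')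
  show "(I +>\<^bsub>A\<^esub> x) \<oplus>\<^bsub>alg_quot A I\<^esub> (I +>\<^bsub>A\<^esub> y) = I +>\<^bsub>A\<^esub> (x \<oplus>\<^bsub>A\<^esub> y)"
    if "x \<in> carrier A" "y \<in> carrier A" for x y
    using I.a_rcos_sum[OF that] by (simp add: alg_quot_def)
  show "\<zero>\<^bsub>alg_quot A I\<^esub> = I +>\<^bsub>A\<^esub> \<zero>\<^bsub>A\<^esub>"
    by (simp add: alg_quot_def I.a_subset)
  show "I +>\<^bsub>A\<^esub> x = I +>\<^bsub>A\<^esub> \<zero>\<^bsub>A\<^esub> \<longleftrightarrow> x \<in> I" if "x \<in> carrier A" for x
    using that A.a_coset_join1[OF _ that sg] A.a_coset_join2[OF that sg] by (auto simp: I.a_subset)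
  show "c \<odot>\<^bsub>alg_quot A I\<^esub> (I +>\<^bsub>A\<^esub> x) = I +>\<^bsub>A\<^esub> (c \<odot>\<^bsub>A\<^esub> x)" if x: "x \<in> carrier A" for c x
  proof -
    have "I +>\<^bsub>A\<^esub> (c \<odot>\<^bsub>A\<^esub> a) = I +>\<^bsub>A\<^esub> (c \<odot>\<^bsub>A\<^esub> x)" if aa: "a \<in> I +>\<^bsub>A\<^esub> x" for a
      proof -
      obtain i where "i \<in> I" "a = i \<oplus>\<^bsub>A\<^esub> x" using aa mem[of a x] by blast
      then show ?thesis using x eqI[of "c \<odot>\<^bsub>A\<^esub> i" "c \<odot>\<^bsub>A\<^esub> x"] Ism smc dist IA by metis
    qed
    then show ?thesis unfolding alg_quot_def module.simps by (rule UN_eq_const[OF self[OF x]])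
  qed
  show "(I +>\<^bsub>A\<^esub> x) \<otimes>\<^bsub>alg_quot A I\<^esub> (I +>\<^bsub>A\<^esub> y) = I +>\<^bsub>A\<^esub> (x \<otimes>\<^bsub>A\<^esub> y)"
    if x: "x \<in> carrier A" and y: "y \<in> carrier A" for x y
  proof -
    have "I +>\<^bsub>A\<^esub> (a \<otimes>\<^bsub>A\<^esub> b) = I +>\<^bsub>A\<^esub> (x \<otimes>\<^bsub>A\<^esub> y)" if a: "a \<in> I +>\<^bsub>A\<^esub> x" and b: "b \<in> I +>\<^bsub>A\<^esub> y" for a b
    proof -
      obtain i j where ij: "i \<in> I" "j \<in> I" "a = i \<oplus>\<^bsub>A\<^esub> x" "b = j \<oplus>\<^bsub>A\<^esub> y" using a b unfolding mem by auto
      have 1: "i \<otimes>\<^bsub>A\<^esub> b \<in> I" "x \<otimes>\<^bsub>A\<^esub> j \<in> I" using I ij x y IA by (auto simp: alg_ideal_def)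
      have "a \<otimes>\<^bsub>A\<^esub> b = i \<otimes>\<^bsub>A\<^esub> b \<oplus>\<^bsub>A\<^esub> (x \<otimes>\<^bsub>A\<^esub> j \<oplus>\<^bsub>A\<^esub> x \<otimes>\<^bsub>A\<^esub> y)"
        using ij x y IA by (simp add: A.prod_add_left A.prod_add_right A.prod_closed A.a_ac)
      then show ?thesis using 1 x y IA by (simp add: eqI A.prod_closed)
    qed
    then show ?thesis unfolding alg_quot_def monoid.simps rcoset_mult_def
      by (intro UN_eq_const[OF self[OF x]] UN_eq_const[OF self[OF y]])
  qed
qed

lemma lie_algebra_alg_quot:
  assumes A: "nonassoc_algebra A" and I: "alg_ideal I A" and r: "lie_relations A \<subseteq> I"
  shows "lie_algebra (alg_quot A I)"
proof -
  interpret A: nonassoc_algebra A by fact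
  note q = quot_facts[OF A I]
  have smc: "\<And>c x. x \<in> carrier A \<Longrightarrow> c \<odot>\<^bsub>A\<^esub> x \<in> carrier A" using A.smult_closed by simp
  have ag: "abelian_group (alg_quot A I)"
  proof (rule abelian_groupI)
    fix x assume "x \<in> carrier (alg_quot A I)"
    then obtain a where "a \<in> carrier A" "x = I +>\<^bsub>A\<^esub> a" by (auto simp: q)
    then show "\<exists>y\<in>carrier (alg_quot A I). y \<oplus>\<^bsub>alg_quot A I\<^esub> x = \<zero>\<^bsub>alg_quot A I\<^esub>"
      by (intro bexI[of _ "I +>\<^bsub>A\<^esub> (\<ominus>\<^bsub>A\<^esub> a)"]) (auto simp: q A.l_neg)
  qed (auto simp only: q image_iff A.a_closed A.a_ac A.l_zero A.zero_closed, (metis A.add.m_closed A.zero_closed A.a_assoc A.a_comm A.l_zero)+)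
  show ?thesis
  proof (intro lie_algebra.intro nonassoc_algebra.intro module.intro real_ring_cring ag
      module_axioms.intro nonassoc_algebra_axioms.intro lie_algebra_axioms.intro, goal_cases)
    case (11 x)
    then obtain a where a: "a \<in> carrier A" "x = I +>\<^bsub>A\<^esub> a" by (auto simp: q)
    then have "a \<otimes>\<^bsub>A\<^esub> a \<in> I" using r by (auto simp: lie_relations_def)
    then show ?case using a q(6)[OF A.prod_closed[OF a(1) a(1)]] by (simp add: q(3,5))
  next
    case (12 x y z)
    then obtain a b c where a: "a \<in> carrier A" "x = I +>\<^bsub>A\<^esub> a" "b \<in> carrier A" "y = I +>\<^bsub>A\<^esub> b"
      "c \<in> carrier A" "z = I +>\<^bsub>A\<^esub> c" by (auto simp: q)
    let ?j = "a \<otimes>\<^bsub>A\<^esub> (b \<otimes>\<^bsub>A\<^esub> c) \<oplus>\<^bsub>A\<^esub> b \<otimes>\<^bsub>A\<^esub> (c \<otimes>\<^bsub>A\<^esub> a) \<oplus>\<^bsub>A\<^esub> c \<otimes>\<^bsub>A\<^esub> (a \<otimes>\<^bsub>A\<^esub> b)"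
    have "?j \<in> lie_relations A" unfolding lie_relations_def using a by blast
    then have j: "?j \<in> I" "?j \<in> carrier A" using r a by (auto simp: A.prod_closed)
    then show ?case using a q(6)[OF j(2)] by (simp add: q(2,3,5) A.prod_closed)
  qed (use A.smult_l_distr A.smult_r_distr A.smult_assoc1 A.smult_one in
    \<open>auto simp: q smc A.prod_closed A.prod_add_left A.prod_add_right A.prod_smult_left A.prod_smult_right\<close>)
qed

lemma nonassoc_algebra_free_nonassoc: "nonassoc_algebra (free_nonassoc m)"
proof -
  let ?A = "free_nonassoc m"
  have sub: "finite {w. p w \<noteq> 0} \<Longrightarrow> finite {w. q w \<noteq> 0} \<Longrightarrow> finite {w. p w + q w \<noteq> (0::real)}"
    for p q :: "word \<Rightarrow> real"
    by (rule finite_subset[of _ "{w. p w \<noteq> 0} \<union> {w. q w \<noteq> 0}"]) auto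
  have pr: "finite {w. (case w of Gen i \<Rightarrow> 0 | Br u v \<Rightarrow> p u * q v) \<noteq> (0::real)}"
    if "finite {w. p w \<noteq> 0}" "finite {w. q w \<noteq> 0}" for p q :: "word \<Rightarrow> real"
    by (rule finite_subset[of _ "(\<lambda>(u,v). Br u v) ` ({w. p w \<noteq> 0} \<times> {w. q w \<noteq> 0})"])
       (use that in \<open>auto split: word.splits simp: image_iff, metis word.exhaust\<close>)
  have ag: "abelian_group ?A"
  proof (rule abelian_groupI)
    fix p assume "p \<in> carrier ?A"
    then show "\<exists>y\<in>carrier ?A. y \<oplus>\<^bsub>?A\<^esub> p = \<zero>\<^bsub>?A\<^esub>"
      by (intro bexI[of _ "\<lambda>w. - p w"]) (auto simp: free_nonassoc_def)
  next
    fix p q assume "p \<in> carrier ?A" "q \<in> carrier ?A"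
    then show "p \<oplus>\<^bsub>?A\<^esub> q \<in> carrier ?A" using sub
      by (auto simp: free_nonassoc_def subset_iff) (metis add.right_neutral)
  qed (auto simp: free_nonassoc_def)
  show ?thesis
  proof (intro nonassoc_algebra.intro module.intro real_ring_cring ag
      module_axioms.intro nonassoc_algebra_axioms.intro, goal_cases)
    case (6 p q) then show ?case using pr[of p q] by (auto simp: free_nonassoc_def split: word.splits)
  qed (auto simp: free_nonassoc_def algebra_simps fun_eq_iff split: word.splits intro: finite_subset[rotated])
qed

lemma gen_ideal:
  assumes A: "nonassoc_algebra A" and S: "S \<subseteq> carrier A"
  shows "alg_ideal (gen_alg_ideal A S) A" "S \<subseteq> gen_alg_ideal A S"
proof -
  interpret A: nonassoc_algebra A by fact
  have c: "alg_ideal (carrier A) A"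
    by (auto simp: alg_ideal_def A.carrier_is_submodule A.prod_closed)
  note E = A.submoduleE
  show "S \<subseteq> gen_alg_ideal A S" by (auto simp: gen_alg_ideal_def)
  have z: "\<zero>\<^bsub>A\<^esub> \<in> J" if "alg_ideal J A" for J
    using subgroup.one_closed[OF submodule.axioms(1), of J real_ring A] that by (simp add: alg_ideal_def)
  have "submodule (gen_alg_ideal A S) real_ring A"
  proof (rule A.submoduleI)
    show "gen_alg_ideal A S \<subseteq> carrier A" using c S by (auto simp: gen_alg_ideal_def)
    show "\<zero>\<^bsub>A\<^esub> \<in> gen_alg_ideal A S" using z by (auto simp: gen_alg_ideal_def)
    show "\<ominus>\<^bsub>A\<^esub> a \<in> gen_alg_ideal A S" if "a \<in> gen_alg_ideal A S" for a
      using that E(3) unfolding gen_alg_ideal_def alg_ideal_def by blast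
    show "a \<oplus>\<^bsub>A\<^esub> b \<in> gen_alg_ideal A S" if "a \<in> gen_alg_ideal A S" "b \<in> gen_alg_ideal A S" for a b
      using that E(5) unfolding gen_alg_ideal_def alg_ideal_def by blast
    show "k \<odot>\<^bsub>A\<^esub> b \<in> gen_alg_ideal A S" if "k \<in> carrier real_ring" "b \<in> gen_alg_ideal A S" for k b
      using that E(4) unfolding gen_alg_ideal_def alg_ideal_def by blast
  qed
  then show "alg_ideal (gen_alg_ideal A S) A"
    by (auto simp: alg_ideal_def gen_alg_ideal_def)
qed

lemma lie_relations_sub: assumes "nonassoc_algebra A" shows "lie_relations A \<subseteq> carrier A"
proof -
  interpret A: nonassoc_algebra A by fact
  show ?thesis by (auto simp: lie_relations_def intro!: A.prod_closed)
qed

lemmas lie_ideal_facts = gen_ideal[OF nonassoc_algebra_free_nonassoc lie_relations_sub[OF nonassoc_algebra_free_nonassoc], folded lie_ideal_def]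

theorem lie_algebra_free_lie: "lie_algebra (free_lie m)"
  unfolding free_lie_def by (rule lie_algebra_alg_quot[OF nonassoc_algebra_free_nonassoc lie_ideal_facts])

lemma degree_gt_ideal: "alg_ideal (degree_gt m s) (free_lie m)"
proof -
  let ?A = "free_nonassoc m" and ?L = "free_lie m"
  interpret L: lie_algebra ?L by (rule lie_algebra_free_lie)
  interpret A: nonassoc_algebra ?A by (rule nonassoc_algebra_free_nonassoc)
  note q = quot_facts[OF nonassoc_algebra_free_nonassoc lie_ideal_facts(1), folded free_lie_def]
  define D where "D = {p \<in> carrier ?A. \<forall>w. p w \<noteq> 0 \<longrightarrow> word_degree w > s}"
  have D: "degree_gt m s = (\<lambda>x. lie_ideal m +>\<^bsub>?A\<^esub> x) ` D" by (auto simp: degree_gt_def D_def)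
  have D1: "p \<oplus>\<^bsub>?A\<^esub> r \<in> D" if "p \<in> D" "r \<in> D" for p r
    using that A.a_closed[of p r] by (auto simp: D_def free_nonassoc_def) (metis add.right_neutral)
  have smc: "\<And>c x. x \<in> carrier ?A \<Longrightarrow> c \<odot>\<^bsub>?A\<^esub> x \<in> carrier ?A" using A.smult_closed by simp
  have D2: "c \<odot>\<^bsub>?A\<^esub> p \<in> D" if "p \<in> D" for p c
    using that smc[of p c] by (auto simp: D_def) (auto simp: free_nonassoc_def)
  have D3: "x \<otimes>\<^bsub>?A\<^esub> p \<in> D \<and> p \<otimes>\<^bsub>?A\<^esub> x \<in> D" if "p \<in> D" "x \<in> carrier ?A" for p x
    using that A.prod_closed[of p x] A.prod_closed[of x p]
    by (auto simp: D_def) (fastforce simp: free_nonassoc_def split: word.splits)+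
  have D4: "\<zero>\<^bsub>?A\<^esub> \<in> D" using A.zero_closed by (auto simp: D_def) (auto simp: free_nonassoc_def)
  have DA: "D \<subseteq> carrier ?A" by (auto simp: D_def)
  have neg: "\<ominus>\<^bsub>?L\<^esub> a = (-1) \<odot>\<^bsub>?L\<^esub> a" if "a \<in> carrier ?L" for a
  proof -
    have "((-1) + 1) \<odot>\<^bsub>?L\<^esub> a = (-1) \<odot>\<^bsub>?L\<^esub> a \<oplus>\<^bsub>?L\<^esub> 1 \<odot>\<^bsub>?L\<^esub> a"
      using L.smult_l_distr[of "-1" 1 a] that by simp
    then have "(-1) \<odot>\<^bsub>?L\<^esub> a \<oplus>\<^bsub>?L\<^esub> a = \<zero>\<^bsub>?L\<^esub>"
      using L.smult_one[OF that] L.smult_l_null[OF that] by simp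
    then show ?thesis using that L.smult_closed[of "-1" a] by (intro L.minus_equality) auto
  qed
  have sm: "c \<odot>\<^bsub>?L\<^esub> a \<in> degree_gt m s" if "a \<in> degree_gt m s" for a c
    using that DA D2 by (auto simp: D q)
  have sub: "degree_gt m s \<subseteq> carrier ?L" using DA by (auto simp: D q)
  have "submodule (degree_gt m s) real_ring ?L"
  proof (rule L.submoduleI)
    show "\<zero>\<^bsub>?L\<^esub> \<in> degree_gt m s" using D4 by (auto simp: D q)
    show "\<ominus>\<^bsub>?L\<^esub> a \<in> degree_gt m s" if "a \<in> degree_gt m s" for a
      using that sub neg sm by auto
    show "a \<oplus>\<^bsub>?L\<^esub> b \<in> degree_gt m s" if "a \<in> degree_gt m s" "b \<in> degree_gt m s" for a b
      using that D1 DA by (auto simp: D q subset_iff)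
  qed (use sub sm in auto)
  moreover have "x \<otimes>\<^bsub>?L\<^esub> i \<in> degree_gt m s \<and> i \<otimes>\<^bsub>?L\<^esub> x \<in> degree_gt m s"
    if "x \<in> carrier ?L" "i \<in> degree_gt m s" for x i
    using that D3 DA by (auto simp: D q subset_iff)
  ultimately show ?thesis by (simp add: alg_ideal_def)
qed

theorem lie_algebra_free_nilpotent: "lie_algebra (free_nilpotent m s)"
  unfolding free_nilpotent_def
proof (rule lie_algebra_alg_quot)
  interpret L: lie_algebra "free_lie m" by (rule lie_algebra_free_lie)
  show "nonassoc_algebra (free_lie m)" by (rule L.nonassoc_algebra_axioms)
  have "lie_relations (free_lie m) \<subseteq> {\<zero>\<^bsub>free_lie m\<^esub>}"
    using L.bracket_self L.jacobi by (auto simp: lie_relations_def)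
  moreover have "\<zero>\<^bsub>free_lie m\<^esub> \<in> degree_gt m s"
    using subgroup.one_closed[OF submodule.axioms(1), of "degree_gt m s" real_ring "free_lie m"]
      degree_gt_ideal[of m s] by (simp add: alg_ideal_def)
  ultimately show "lie_relations (free_lie m) \<subseteq> degree_gt m s" by auto
qed (rule degree_gt_ideal)

theorem lie_algebra_cotangent:
  assumes "lie_algebra L" shows "lie_algebra (cotangent L)"
proof -
  interpret L: lie_algebra L by fact
  let ?T = "cotangent L"
  have smc: "\<And>c x. x \<in> carrier L \<Longrightarrow> c \<odot>\<^bsub>L\<^esub> x \<in> carrier L" using L.smult_closed by simp
  have z: "\<alpha> \<zero>\<^bsub>L\<^esub> = 0" if "\<alpha> \<in> carrier (dual_space L)" for \<alpha>
  proof -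
    have "\<alpha> (\<zero>\<^bsub>L\<^esub> \<oplus>\<^bsub>L\<^esub> \<zero>\<^bsub>L\<^esub>) = \<alpha> \<zero>\<^bsub>L\<^esub> + \<alpha> \<zero>\<^bsub>L\<^esub>"
      using that L.zero_closed unfolding dual_space_def by (auto simp del: L.r_zero L.l_zero)
    then show ?thesis by simp
  qed
  have ad: "\<alpha> (x \<oplus>\<^bsub>L\<^esub> y) = \<alpha> x + \<alpha> y" if "\<alpha> \<in> carrier (dual_space L)" "x \<in> carrier L" "y \<in> carrier L" for \<alpha> x y
    using that by (auto simp: dual_space_def)
  have sc: "\<alpha> (c \<odot>\<^bsub>L\<^esub> x) = c * \<alpha> x" if "\<alpha> \<in> carrier (dual_space L)" "x \<in> carrier L" for \<alpha> c x
    using that by (auto simp: dual_space_def)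
  have anti: "\<alpha> (x \<otimes>\<^bsub>L\<^esub> y) = - \<alpha> (y \<otimes>\<^bsub>L\<^esub> x)" if "\<alpha> \<in> carrier (dual_space L)" "x \<in> carrier L" "y \<in> carrier L" for \<alpha> x y
  proof -
    have "0 = \<alpha> ((x \<oplus>\<^bsub>L\<^esub> y) \<otimes>\<^bsub>L\<^esub> (x \<oplus>\<^bsub>L\<^esub> y))" using that z by (simp add: L.bracket_self)
    also have "(x \<oplus>\<^bsub>L\<^esub> y) \<otimes>\<^bsub>L\<^esub> (x \<oplus>\<^bsub>L\<^esub> y) =
        (x \<otimes>\<^bsub>L\<^esub> x \<oplus>\<^bsub>L\<^esub> x \<otimes>\<^bsub>L\<^esub> y) \<oplus>\<^bsub>L\<^esub> (y \<otimes>\<^bsub>L\<^esub> x \<oplus>\<^bsub>L\<^esub> y \<otimes>\<^bsub>L\<^esub> y)"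
      using that L.prod_add_left[of x y "x \<oplus>\<^bsub>L\<^esub> y"] by (simp add: L.prod_add_right)
    finally show ?thesis using that
      by (simp add: L.prod_closed ad L.bracket_self z)
  qed
  have jac: "\<alpha> (x \<otimes>\<^bsub>L\<^esub> (y \<otimes>\<^bsub>L\<^esub> w)) + \<alpha> (y \<otimes>\<^bsub>L\<^esub> (w \<otimes>\<^bsub>L\<^esub> x)) + \<alpha> (w \<otimes>\<^bsub>L\<^esub> (x \<otimes>\<^bsub>L\<^esub> y)) = 0"
    if "\<alpha> \<in> carrier (dual_space L)" "x \<in> carrier L" "y \<in> carrier L" "w \<in> carrier L" for \<alpha> x y w
  proof -
    have "\<alpha> (x \<otimes>\<^bsub>L\<^esub> (y \<otimes>\<^bsub>L\<^esub> w) \<oplus>\<^bsub>L\<^esub> y \<otimes>\<^bsub>L\<^esub> (w \<otimes>\<^bsub>L\<^esub> x) \<oplus>\<^bsub>L\<^esub> w \<otimes>\<^bsub>L\<^esub> (x \<otimes>\<^bsub>L\<^esub> y)) = 0"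
      using L.jacobi that z by simp
    then show ?thesis using that by (simp add: ad L.prod_closed)
  qed
  have ext: "\<alpha> = \<beta>" if "\<alpha> \<in> carrier (dual_space L)" "\<beta> \<in> carrier (dual_space L)"
     "\<And>x. x \<in> carrier L \<Longrightarrow> \<alpha> x = \<beta> x" for \<alpha> \<beta>
    using that by (auto simp: dual_space_def intro: extensionalityI)
  define S where "S \<alpha> \<beta> = \<alpha> \<oplus>\<^bsub>dual_space L\<^esub> \<beta>" for \<alpha> \<beta>
  define M where "M c \<alpha> = c \<odot>\<^bsub>dual_space L\<^esub> \<alpha>" for c \<alpha>
  define Z where "Z = \<zero>\<^bsub>dual_space L\<^esub>"
  have ap: "S \<alpha> \<beta> x = \<alpha> x + \<beta> x" "M c \<alpha> x = c * \<alpha> x" "coad L y \<alpha> x = - \<alpha> (y \<otimes>\<^bsub>L\<^esub> x)" "Z x = 0"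
    if "x \<in> carrier L" for \<alpha> \<beta> x c y
    using that by (auto simp: S_def M_def Z_def dual_space_def coad_def)
  have cl: "S \<alpha> \<beta> \<in> carrier (dual_space L)" "M c \<alpha> \<in> carrier (dual_space L)" "Z \<in> carrier (dual_space L)"
    if "\<alpha> \<in> carrier (dual_space L)" "\<beta> \<in> carrier (dual_space L)" for \<alpha> \<beta> c
    using that smc by (auto simp: S_def M_def Z_def dual_space_def algebra_simps)
  have Zc: "Z \<in> carrier (dual_space L)"  by (auto simp: Z_def dual_space_def smc)
  have cc: "coad L y \<alpha> \<in> carrier (dual_space L)" if "\<alpha> \<in> carrier (dual_space L)" "y \<in> carrier L" for \<alpha> y
    using that ad[OF that(1)] sc[OF that(1)] smc
    by (subst dual_space_def)
       (auto simp: coad_def L.prod_add_right L.prod_smult_right L.prod_closed)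
  have T: "carrier ?T = carrier L \<times> carrier (dual_space L)"
    "(x,\<alpha>) \<oplus>\<^bsub>?T\<^esub> (y,\<beta>) = (x \<oplus>\<^bsub>L\<^esub> y, S \<alpha> \<beta>)" "c \<odot>\<^bsub>?T\<^esub> (x,\<alpha>) = (c \<odot>\<^bsub>L\<^esub> x, M c \<alpha>)"
    "(x,\<alpha>) \<otimes>\<^bsub>?T\<^esub> (y,\<beta>) = (x \<otimes>\<^bsub>L\<^esub> y, S (coad L x \<beta>) (M (-1) (coad L y \<alpha>)))"
    "\<zero>\<^bsub>?T\<^esub> = (\<zero>\<^bsub>L\<^esub>, Z)" for x y \<alpha> \<beta> c
    by (auto simp: cotangent_def S_def M_def Z_def)
  have ag: "abelian_group ?T"
  proof (rule abelian_groupI)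
    fix p assume "p \<in> carrier ?T"
    then show "\<exists>y\<in>carrier ?T. y \<oplus>\<^bsub>?T\<^esub> p = \<zero>\<^bsub>?T\<^esub>"
      by (intro bexI[of _ "(\<ominus>\<^bsub>L\<^esub> fst p, M (-1) (snd p))"])
         (auto simp: T L.l_neg cl Zc ap intro!: ext)
  qed (auto simp: T cl Zc ap L.a_ac intro!: ext)
  show ?thesis
  proof (intro lie_algebra.intro nonassoc_algebra.intro module.intro real_ring_cring ag
      module_axioms.intro nonassoc_algebra_axioms.intro lie_algebra_axioms.intro, goal_cases)
    case (12 u v w)
    obtain x \<alpha> y \<beta> z \<gamma> where e: "u = (x,\<alpha>)" "v = (y,\<beta>)" "w = (z,\<gamma>)" by (metis surj_pair)
    have c: "x \<in> carrier L" "y \<in> carrier L" "z \<in> carrier L"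
      "\<alpha> \<in> carrier (dual_space L)" "\<beta> \<in> carrier (dual_space L)" "\<gamma> \<in> carrier (dual_space L)"
      using 12 by (auto simp: e T)
    note a = anti[OF _ L.prod_closed]
    show ?case unfolding e T prod.inject
    proof (intro conjI ext, goal_cases)
      case (4 t)
      have "\<delta> (p \<otimes>\<^bsub>L\<^esub> (r \<otimes>\<^bsub>L\<^esub> t)) - \<delta> (r \<otimes>\<^bsub>L\<^esub> (p \<otimes>\<^bsub>L\<^esub> t)) = \<delta> ((p \<otimes>\<^bsub>L\<^esub> r) \<otimes>\<^bsub>L\<^esub> t)"
        if d: "\<delta> \<in> carrier (dual_space L)" "p \<in> carrier L" "r \<in> carrier L" for \<delta> p r
      proof -
        let ?r = "coad L r \<delta>"
        have 1: "\<delta> (r \<otimes>\<^bsub>L\<^esub> (t \<otimes>\<^bsub>L\<^esub> p)) = - \<delta> (r \<otimes>\<^bsub>L\<^esub> (p \<otimes>\<^bsub>L\<^esub> t))"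
          using anti[OF cc[OF d(1,3)] 4 d(2)] d 4 by (simp add: ap L.prod_closed)
        have 2: "\<delta> (t \<otimes>\<^bsub>L\<^esub> (p \<otimes>\<^bsub>L\<^esub> r)) = - \<delta> ((p \<otimes>\<^bsub>L\<^esub> r) \<otimes>\<^bsub>L\<^esub> t)"
          using d 4 by (intro anti) (auto simp: L.prod_closed)
        show ?thesis using jac[OF d 4] 1 2 by simp
      qed
      note k = this
      show ?case using 4 c k[OF c(6) c(1,2)] k[OF c(4) c(2,3)] k[OF c(5) c(3,1)]
        by (simp add: ap L.prod_closed)
    qed (use c in \<open>auto simp: L.jacobi cl cc Zc L.prod_closed\<close>)
  qed (use L.smult_l_distr L.smult_r_distr L.smult_assoc1 L.smult_one in
    \<open>auto simp: T cl cc Zc ap smc ad sc L.prod_closed L.bracket_self L.prod_add_left L.prod_add_right L.prod_smult_left L.prod_smult_right algebra_simps intro!: ext\<close>)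
qed

end

theory Submission
  imports Defs
begin

text \<open>
  A basis is nice iff two indices of a nonzero structure constant always determine the third. In the
  cotangent Lie algebra the structure constants become an alternating 3-form, so this property passes
  from a Lie algebra to its cotangent Lie algebra (\<open>nice_cotangent\<close>). It therefore suffices to find
  nice bases of the small free nilpotent Lie algebras and to exclude nice bases of the cotangent Lie
  algebras of the others.

  For the first part: the free nilpotent Lie algebra is graded by multidegree. If words with pairwise
  distinct multidegrees form a basis, then this basis is nice, because two multidegrees in a bracket
  relation determine the third (\<open>nice_if_distinct_multidegrees\<close>). Such a basis exists up to step 2,
  and on two generators up to step 4; in the latter case \<open>[x, [y, [x, y]]] = [y, [x, [x, y]]]\<close> is the
  reason why bidegree \<open>(2, 2)\<close> is one-dimensional.

  For the second part, let \<open>L\<close> be any Lie algebra with a surjection onto a free nilpotent one; for the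
  cotangent Lie algebra this is the first projection. In a nice basis of \<open>L\<close> one finds two vectors, or
  three if there are at least three generators, with images that are linearly independent modulo the
  derived algebra.
  All bracket words in these vectors are multiples of basis vectors. A Jacobi identity among them
  writes zero as a sum of three multiples of basis vectors, which is impossible if the three terms are
  pairwise independent. With three generators \<open>x, y, z\<close> and step 3, the Jacobi identity of \<open>x, y, z\<close> is
  of this kind; with two generators and step 5, that of \<open>x, y, [x, [x, y]]\<close> is
  (\<open>nonnice_if_onto_free_nilpotent\<close>).

  Independence, here and in the first part, is tested by coefficients of monomials in the expansion of
  Lie words in the free associative algebra. These are realised as entries of the matrices of weighted
  shift operators; letting the generators act by shifts shows at once that they are well-defined
  linear forms on the free nilpotent Lie algebra. In the second part the chosen vectors are generators
  only up to a linear change of coordinates and terms of higher degree. The weights of the shifts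
  undo the former (\<open>dual_system_exists\<close>), and the latter do not affect the relevant entries
  (\<open>leading_word_eval\<close>).
\<close>

section \<open>Linear forms and bases\<close>

text \<open>
  \<^const>\<open>dual_space\<close> is defined for plain records, so the locales of algebras are specialised
  to these.
\<close>

locale plain_algebra = nonassoc_algebra A for A :: "(real, 'a) module" (structure)

locale plain_lie_algebra = lie_algebra L for L :: "(real, 'a) module" (structure)

sublocale plain_lie_algebra \<subseteq> plain_algebra L
  by unfold_locales

context plain_algebra
begin

lemma smult_in_carrier: "x \<in> carrier A \<Longrightarrow> c \<odot> x \<in> carrier A"
  by simp

lemma zero_smult: "x \<in> carrier A \<Longrightarrow> 0 \<odot> x = \<zero>"
  using smult_l_null[of x] by simp

lemma minus_eq_zeroD:
  assumes "x \<ominus> y = \<zero>" "x \<in> carrier A" "y \<in> carrier A"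
  shows "x = y"
proof -
  have "x = (x \<ominus> y) \<oplus> y"
    using assms(2,3) by (simp add: a_minus_def a_assoc l_neg)
  then show ?thesis
    using assms by simp
qed

lemma form_closedD:
  assumes "\<phi> \<in> carrier (dual_space A)"
  shows form_add: "\<lbrakk>x \<in> carrier A; y \<in> carrier A\<rbrakk> \<Longrightarrow> \<phi> (x \<oplus> y) = \<phi> x + \<phi> y"
    and form_smult: "x \<in> carrier A \<Longrightarrow> \<phi> (c \<odot> x) = c * \<phi> x"
    and form_extensional: "\<phi> \<in> extensional (carrier A)"
  using assms by (auto simp: dual_space_def)

lemma form_zero:
  assumes "\<phi> \<in> carrier (dual_space A)"
  shows "\<phi> \<zero> = 0"
  using form_add[OF assms, of \<zero> \<zero>] by simp

lemma form_minus:
  assumes "\<phi> \<in> carrier (dual_space A)" "x \<in> carrier A" "y \<in> carrier A"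
  shows "\<phi> (x \<ominus> y) = \<phi> x - \<phi> y"
proof -
  have "\<phi> (\<ominus> y) + \<phi> y = 0"
    using form_add[OF assms(1), of "\<ominus> y" y] assms form_zero[OF assms(1)] by (simp add: l_neg)
  then show ?thesis
    using form_add[OF assms(1), of x "\<ominus> y"] assms by (simp add: minus_eq)
qed

lemma form_eqI:
  assumes "\<phi> \<in> carrier (dual_space A)" "\<psi> \<in> carrier (dual_space A)"
    and "\<And>x. x \<in> carrier A \<Longrightarrow> \<phi> x = \<psi> x"
  shows "\<phi> = \<psi>"
  using assms form_extensional by (blast intro: extensionalityI)

lemma lin_comb_0: "lin_comb A 0 e c = \<zero>"
  by (simp add: lin_comb_def)

lemma lin_comb_closed: "(\<And>i. i < n \<Longrightarrow> e i \<in> carrier A) \<Longrightarrow> lin_comb A n e c \<in> carrier A"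
  unfolding lin_comb_def by (rule finsum_closed) auto

lemma lin_comb_Suc:
  assumes "\<And>i. i < Suc n \<Longrightarrow> e i \<in> carrier A"
  shows "lin_comb A (Suc n) e c = c n \<odot> e n \<oplus> lin_comb A n e c"
  using assms unfolding lin_comb_def lessThan_Suc by (subst finsum_insert) auto

lemma lin_comb_add:
  assumes "\<And>i. i < n \<Longrightarrow> e i \<in> carrier A"
  shows "lin_comb A n e c \<oplus> lin_comb A n e d = lin_comb A n e (\<lambda>i. c i + d i)"
proof -
  have "(\<Oplus>i\<in>{..<n}. (c i + d i) \<odot> e i) = (\<Oplus>i\<in>{..<n}. c i \<odot> e i \<oplus> d i \<odot> e i)"
    using assms smult_l_distr by (intro finsum_cong') auto
  then show ?thesis
    using assms unfolding lin_comb_def by (subst (asm) finsum_addf) auto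
qed

lemma lin_comb_smult:
  assumes "\<And>i. i < n \<Longrightarrow> e i \<in> carrier A"
  shows "a \<odot> lin_comb A n e c = lin_comb A n e (\<lambda>i. a * c i)"
proof -
  have "(\<Oplus>i\<in>{..<n}. (a * c i) \<odot> e i) = (\<Oplus>i\<in>{..<n}. a \<odot> (c i \<odot> e i))"
    using assms smult_assoc1 by (intro finsum_cong') auto
  then show ?thesis
    using assms unfolding lin_comb_def by (subst finsum_smult_ldistr) auto
qed

lemma lin_comb_zero:
  assumes "\<And>i. i < n \<Longrightarrow> e i \<in> carrier A" "\<And>i. i < n \<Longrightarrow> c i = 0"
  shows "lin_comb A n e c = \<zero>"
proof -
  have "(\<Oplus>i\<in>{..<n}. c i \<odot> e i) = (\<Oplus>i\<in>{..<n}. \<zero>)"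
    using assms by (intro finsum_cong') (auto simp: zero_smult)
  then show ?thesis
    by (simp add: lin_comb_def)
qed

lemma lin_comb_induct:
  assumes "\<And>i. i < n \<Longrightarrow> e i \<in> carrier A" "\<And>i. i < n \<Longrightarrow> P (e i)" "P \<zero>"
    and "\<And>x y. \<lbrakk>x \<in> carrier A; y \<in> carrier A; P x; P y\<rbrakk> \<Longrightarrow> P (x \<oplus> y)"
    and "\<And>c x. \<lbrakk>x \<in> carrier A; P x\<rbrakk> \<Longrightarrow> P (c \<odot> x)"
  shows "P (lin_comb A n e c)"
  using assms(1,2)
proof (induction n)
  case 0
  then show ?case using assms(3) by (simp add: lin_comb_0)
next
  case (Suc n)
  then show ?case
    using assms(4)[of "c n \<odot> e n" "lin_comb A n e c"] assms(5)[of "e n" "c n"]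
    by (simp add: lin_comb_Suc lin_comb_closed)
qed

lemma basis_vector_lin_comb:
  assumes "\<And>i. i < n \<Longrightarrow> e i \<in> carrier A" "j < n"
  shows "e j = lin_comb A n e (\<lambda>i. of_bool (i = j))"
  using assms
proof (induction n)
  case (Suc n)
  show ?case
  proof (cases "j = n")
    case True
    then have "lin_comb A n e (\<lambda>i. of_bool (i = j)) = \<zero>"
      using Suc.prems by (intro lin_comb_zero) auto
    with True Suc.prems show ?thesis
      using smult_one by (simp add: lin_comb_Suc)
  next
    case False
    with Suc.prems have "j < n" by simp
    then have "e j = lin_comb A n e (\<lambda>i. of_bool (i = j))"
      using Suc by simp
    with False Suc.prems show ?thesis
      using lin_comb_closed[of n e] by (simp add: lin_comb_Suc zero_smult)
  qed
qed simp

lemma form_lin_comb: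
  assumes "\<phi> \<in> carrier (dual_space A)" "\<And>i. i < n \<Longrightarrow> e i \<in> carrier A"
  shows "\<phi> (lin_comb A n e c) = (\<Sum>i<n. c i * \<phi> (e i))"
  using assms(2)
  by (induction n)
    (simp_all add: lin_comb_0 lin_comb_Suc form_zero[OF assms(1)] form_add[OF assms(1)]
      form_smult[OF assms(1)] lin_comb_closed smult_in_carrier)

lemma form_lin_comb_dual_basis:
  assumes "dual_basis A n e \<epsilon>" "\<And>i. i < n \<Longrightarrow> e i \<in> carrier A" "j < n"
  shows "\<epsilon> j (lin_comb A n e c) = c j"
proof -
  have "\<epsilon> j (lin_comb A n e c) = (\<Sum>i<n. c i * \<epsilon> j (e i))"
    using assms by (intro form_lin_comb) (auto simp: dual_basis_def)
  also have "\<dots> = (\<Sum>i<n. if i = j then c j else 0)"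
    using assms by (intro sum.cong) (auto simp: dual_basis_def)
  finally show ?thesis
    using assms(3) by simp
qed

text \<open>
  Having a dual basis is linear independence; spanning then says that the dual forms separate
  points, because \<open>x \<ominus> lin_comb A n e (\<lambda>i. \<epsilon> i x)\<close> is annihilated by all of them.
\<close>

lemma basis_if_separating:
  assumes e: "\<And>i. i < n \<Longrightarrow> e i \<in> carrier A" and d: "dual_basis A n e \<epsilon>"
    and sep: "\<And>x. \<lbrakk>x \<in> carrier A; \<And>i. i < n \<Longrightarrow> \<epsilon> i x = 0\<rbrakk> \<Longrightarrow> x = \<zero>"
  shows "basis A n e"
  unfolding basis_def
proof (intro conjI allI impI ballI)
  fix c i
  assume "lin_comb A n e c = \<zero>" "i < n"
  then show "c i = 0"
    using form_lin_comb_dual_basis[OF d e, of i c] d form_zero[of "\<epsilon> i"] by (simp add: dual_basis_def)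
next
  fix x
  assume x: "x \<in> carrier A"
  define y where "y = lin_comb A n e (\<lambda>i. \<epsilon> i x)"
  have y: "y \<in> carrier A"
    unfolding y_def using e by (rule lin_comb_closed)
  have "\<epsilon> i (x \<ominus> y) = 0" if "i < n" for i
    using form_minus[OF _ x y, of "\<epsilon> i"] form_lin_comb_dual_basis[OF d e that] d that
    by (simp add: y_def dual_basis_def)
  then have "x \<ominus> y = \<zero>"
    using x y by (intro sep) auto
  then have "x = y"
    using x y by (rule minus_eq_zeroD)
  then show "\<exists>c. x = lin_comb A n e c"
    by (auto simp: y_def)
qed (rule e)

lemma form_eq_on_basis:
  assumes b: "basis A n e" and f: "\<phi> \<in> carrier (dual_space A)" "\<psi> \<in> carrier (dual_space A)"
    and eq: "\<And>i. i < n \<Longrightarrow> \<phi> (e i) = \<psi> (e i)"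
  shows "\<phi> = \<psi>"
proof (rule form_eqI[OF f])
  fix x
  assume "x \<in> carrier A"
  with b obtain c where c: "x = lin_comb A n e c"
    by (auto simp: basis_def)
  have "\<And>i. i < n \<Longrightarrow> e i \<in> carrier A"
    using b by (simp add: basis_def)
  then show "\<phi> x = \<psi> x"
    unfolding c by (simp add: form_lin_comb[OF f(1)] form_lin_comb[OF f(2)] eq)
qed

lemma separating_if_basis:
  assumes b: "basis A n e" and d: "dual_basis A n e \<epsilon>"
    and x: "x \<in> carrier A" "\<And>i. i < n \<Longrightarrow> \<epsilon> i x = 0"
  shows "x = \<zero>"
proof -
  have e: "\<And>i. i < n \<Longrightarrow> e i \<in> carrier A"
    using b by (simp add: basis_def)
  obtain c where c: "x = lin_comb A n e c"
    using b x by (auto simp: basis_def)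
  then show ?thesis
    using x(2) form_lin_comb_dual_basis[OF d e] lin_comb_zero[of n e c] e by simp
qed

end

section \<open>Nice bases and their structure constants\<close>

text \<open>
  In terms of the structure constants \<open>\<epsilon> k (e i \<otimes> e j)\<close> a basis is nice iff every pair \<open>(i, j)\<close> is
  completed by at most one \<open>k\<close>, and every pair \<open>(i, k)\<close> by at most one \<open>j\<close>, to a triple with nonzero
  constant.
\<close>

context plain_lie_algebra
begin

lemma bracket_antisym:
  assumes "x \<in> carrier L" "y \<in> carrier L"
  shows "y \<otimes> x = (-1) \<odot> (x \<otimes> y)"
proof -
  have "\<zero> = (x \<oplus> y) \<otimes> (x \<oplus> y)"
    using assms by (simp add: bracket_self)
  also have "\<dots> = (x \<otimes> x \<oplus> y \<otimes> x) \<oplus> (x \<otimes> y \<oplus> y \<otimes> y)"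
    using assms by (subst prod_add_right) (simp_all add: prod_add_left)
  also have "\<dots> = y \<otimes> x \<oplus> x \<otimes> y"
    using assms by (simp add: prod_closed bracket_self)
  finally have "y \<otimes> x = \<ominus> (x \<otimes> y)"
    using assms by (metis minus_equality prod_closed)
  moreover have "\<ominus> (x \<otimes> y) = (-1) \<odot> (x \<otimes> y)"
    using assms smult_one[of "x \<otimes> y"] minus_equality[of "(-1) \<odot> (x \<otimes> y)" "x \<otimes> y"]
      smult_l_distr[of "-1" 1 "x \<otimes> y"] by (simp add: prod_closed zero_smult)
  ultimately show ?thesis by simp
qed

lemma bracket_zero:
  assumes "x \<in> carrier L"
  shows "\<zero> \<otimes> x = \<zero>" "x \<otimes> \<zero> = \<zero>"
  using prod_smult_left[of x x 0] prod_smult_right[of x x 0] assms by (simp_all add: prod_closed zero_smult)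

lemma form_bracket_antisym:
  assumes "\<phi> \<in> carrier (dual_space L)" "x \<in> carrier L" "y \<in> carrier L"
  shows "\<phi> (y \<otimes> x) = - \<phi> (x \<otimes> y)"
  using bracket_antisym[OF assms(2,3)] form_smult[OF assms(1), of "x \<otimes> y" "-1"] assms
  by (simp add: prod_closed)

lemma contraction_in_dual:
  assumes "\<phi> \<in> carrier (dual_space L)" "x \<in> carrier L"
  shows "interior_prod x (ce_diff L \<phi>) \<in> carrier (dual_space L)"
  using assms form_add[OF assms(1)] form_smult[OF assms(1)]
  by (subst dual_space_def)
    (auto simp: interior_prod_def ce_diff_def prod_add_right prod_smult_right prod_closed
      smult_in_carrier extensional_def)

lemma dual_smult_in_dual:
  assumes "\<phi> \<in> carrier (dual_space L)"
  shows "c \<odot>\<^bsub>dual_space L\<^esub> \<phi> \<in> carrier (dual_space L)"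
  using assms smult_in_carrier by (auto simp: dual_space_def algebra_simps)

lemma nice_basisI:
  assumes e: "\<And>i. i < n \<Longrightarrow> e i \<in> carrier L" and d: "dual_basis L n e \<epsilon>"
    and sep: "\<And>x. \<lbrakk>x \<in> carrier L; \<And>i. i < n \<Longrightarrow> \<epsilon> i x = 0\<rbrakk> \<Longrightarrow> x = \<zero>"
    and uniq1: "\<And>i j k k'. \<lbrakk>i < n; j < n; k < n; k' < n;
      \<epsilon> k (e i \<otimes> e j) \<noteq> 0; \<epsilon> k' (e i \<otimes> e j) \<noteq> 0\<rbrakk> \<Longrightarrow> k = k'"
    and uniq2: "\<And>i j j' k. \<lbrakk>i < n; j < n; j' < n; k < n;
      \<epsilon> k (e i \<otimes> e j) \<noteq> 0; \<epsilon> k (e i \<otimes> e j') \<noteq> 0\<rbrakk> \<Longrightarrow> j = j'"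
  shows "nice_basis L n e"
  unfolding nice_basis_def
proof (intro conjI allI impI exI[of _ \<epsilon>])
  show b: "basis L n e"
    using e d sep by (rule basis_if_separating)
  show "dual_basis L n e \<epsilon>" by fact
  have eps: "\<epsilon> i \<in> carrier (dual_space L)" if "i < n" for i
    using d that by (simp add: dual_basis_def)
  fix i j
  assume ij: "i < n" "j < n"
  show "\<exists>k<n. \<exists>c. e i \<otimes> e j = c \<odot> e k"
  proof -
    obtain k where k: "k < n" "\<And>k'. \<lbrakk>k' < n; \<epsilon> k' (e i \<otimes> e j) \<noteq> 0\<rbrakk> \<Longrightarrow> k' = k"
    proof (cases "\<exists>k<n. \<epsilon> k (e i \<otimes> e j) \<noteq> 0")
      case True
      then show ?thesis using that uniq1[OF ij] by blast
    next
      case False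
      then show ?thesis using that[OF ij(1)] by blast
    qed
    let ?x = "e i \<otimes> e j \<ominus> \<epsilon> k (e i \<otimes> e j) \<odot> e k"
    have "\<epsilon> k' ?x = 0" if "k' < n" for k'
      using k(1) k(2)[OF that] that form_minus[OF eps[OF that], of "e i \<otimes> e j" "\<epsilon> k (e i \<otimes> e j) \<odot> e k"]
        form_smult[OF eps[OF that]] e ij d
      by (cases "k' = k") (auto simp: prod_closed dual_basis_def)
    then have "?x = \<zero>"
      using k(1) ij e by (intro sep) (auto simp: prod_closed)
    then have "e i \<otimes> e j = \<epsilon> k (e i \<otimes> e j) \<odot> e k"
      by (rule minus_eq_zeroD) (use k(1) ij e in \<open>auto simp: prod_closed\<close>)
    then show ?thesis
      using k(1) by blast
  qed
  show "\<exists>k<n. \<exists>c. interior_prod (e i) (ce_diff L (\<epsilon> j)) = c \<odot>\<^bsub>dual_space L\<^esub> \<epsilon> k"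
  proof -
    let ?\<psi> = "interior_prod (e i) (ce_diff L (\<epsilon> j))"
    have \<psi>: "?\<psi> x = - \<epsilon> j (e i \<otimes> x)" if "x \<in> carrier L" for x
      using that e ij by (simp add: interior_prod_def ce_diff_def)
    obtain k where k: "k < n" "\<And>k'. \<lbrakk>k' < n; \<epsilon> j (e i \<otimes> e k') \<noteq> 0\<rbrakk> \<Longrightarrow> k' = k"
    proof (cases "\<exists>k<n. \<epsilon> j (e i \<otimes> e k) \<noteq> 0")
      case True
      then show ?thesis using that uniq2[OF ij(1) _ _ ij(2)] by blast
    next
      case False
      then show ?thesis using that[OF ij(1)] by blast
    qed
    have "?\<psi> = ?\<psi> (e k) \<odot>\<^bsub>dual_space L\<^esub> \<epsilon> k"
    proof (rule form_eq_on_basis[OF b contraction_in_dual dual_smult_in_dual])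
      show "?\<psi> (e l) = (?\<psi> (e k) \<odot>\<^bsub>dual_space L\<^esub> \<epsilon> k) (e l)" if "l < n" for l
        using that k(1) k(2)[OF that] e d
        by (cases "l = k") (auto simp: \<psi> dual_space_def dual_basis_def)
    qed (use eps e ij k(1) in auto)
    then show ?thesis
      using k(1) by blast
  qed
qed

lemma nice_basisD:
  assumes "nice_basis L n e"
  obtains \<epsilon> where "dual_basis L n e \<epsilon>"
    and "\<And>i j k k'. \<lbrakk>i < n; j < n; k < n; k' < n;
      \<epsilon> k (e i \<otimes> e j) \<noteq> 0; \<epsilon> k' (e i \<otimes> e j) \<noteq> 0\<rbrakk> \<Longrightarrow> k = k'"
    and "\<And>i j j' k. \<lbrakk>i < n; j < n; j' < n; k < n;
      \<epsilon> k (e i \<otimes> e j) \<noteq> 0; \<epsilon> k (e i \<otimes> e j') \<noteq> 0\<rbrakk> \<Longrightarrow> j = j'"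
proof -
  obtain \<epsilon> where d: "dual_basis L n e \<epsilon>" and
    c: "\<forall>i<n. \<forall>j<n. \<exists>k<n. \<exists>c. interior_prod (e i) (ce_diff L (\<epsilon> j)) = c \<odot>\<^bsub>dual_space L\<^esub> \<epsilon> k"
    using assms by (auto simp: nice_basis_def)
  have e: "\<And>i. i < n \<Longrightarrow> e i \<in> carrier L"
    using assms by (simp add: nice_basis_def basis_def)
  have br: "\<forall>i<n. \<forall>j<n. \<exists>k<n. \<exists>c. e i \<otimes> e j = c \<odot> e k"
    using assms by (simp add: nice_basis_def)
  have eps: "\<epsilon> i \<in> carrier (dual_space L)" if "i < n" for i
    using d that by (simp add: dual_basis_def)
  show ?thesis
  proof (rule that[OF d])
    fix i j k k'
    assume a: "i < n" "j < n" "k < n" "k' < n" "\<epsilon> k (e i \<otimes> e j) \<noteq> 0" "\<epsilon> k' (e i \<otimes> e j) \<noteq> 0"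
    obtain l c where l: "l < n" "e i \<otimes> e j = c \<odot> e l"
      using br a by blast
    have "\<epsilon> p (e i \<otimes> e j) = (if p = l then c else 0)" if "p < n" for p
      using l d that e form_smult[OF eps[OF that]] by (auto simp: dual_basis_def)
    then show "k = k'"
      using a by (metis (full_types))
  next
    fix i j j' k
    assume a: "i < n" "j < n" "j' < n" "k < n" "\<epsilon> k (e i \<otimes> e j) \<noteq> 0" "\<epsilon> k (e i \<otimes> e j') \<noteq> 0"
    obtain l c where l: "l < n" "interior_prod (e i) (ce_diff L (\<epsilon> k)) = c \<odot>\<^bsub>dual_space L\<^esub> \<epsilon> l"
      using c a by blast
    have "- \<epsilon> k (e i \<otimes> e p) = (if p = l then c else 0)" if "p < n" for p
      using fun_cong[OF l(2), of "e p"] l(1) d that e[OF that] e[OF a(1)]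
      by (auto simp: dual_basis_def interior_prod_def ce_diff_def dual_space_def)
    then show "j = j'"
      using a by (metis (full_types) neg_equal_0_iff_equal)
  qed
qed

end

section \<open>Nice bases of cotangent Lie algebras\<close>

lemma cotangent_ops:
  "carrier (cotangent L) = carrier L \<times> carrier (dual_space L)"
  "fst (z \<oplus>\<^bsub>cotangent L\<^esub> z') = fst z \<oplus>\<^bsub>L\<^esub> fst z'"
  "fst (z \<otimes>\<^bsub>cotangent L\<^esub> z') = fst z \<otimes>\<^bsub>L\<^esub> fst z'"
  "fst (c \<odot>\<^bsub>cotangent L\<^esub> z) = c \<odot>\<^bsub>L\<^esub> fst z"
  "x \<in> carrier L \<Longrightarrow> snd (z \<oplus>\<^bsub>cotangent L\<^esub> z') x = snd z x + snd z' x"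
  "x \<in> carrier L \<Longrightarrow> snd (c \<odot>\<^bsub>cotangent L\<^esub> z) x = c * snd z x"
  "x \<in> carrier L \<Longrightarrow> snd (z \<otimes>\<^bsub>cotangent L\<^esub> z') x =
     snd z (fst z' \<otimes>\<^bsub>L\<^esub> x) - snd z' (fst z \<otimes>\<^bsub>L\<^esub> x)"
  "\<zero>\<^bsub>cotangent L\<^esub> = (\<zero>\<^bsub>L\<^esub>, \<zero>\<^bsub>dual_space L\<^esub>)"
  by (auto simp: cotangent_def dual_space_def coad_def split: prod.splits)

lemma (in plain_lie_algebra) zero_form:
  "\<zero>\<^bsub>dual_space L\<^esub> \<in> carrier (dual_space L)"
  "x \<in> carrier L \<Longrightarrow> \<zero>\<^bsub>dual_space L\<^esub> x = 0"
  using smult_in_carrier by (auto simp: dual_space_def)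

text \<open>
  The pairing of \<open>L\<close> with its dual turns the bracket of the cotangent Lie algebra into an
  alternating 3-form. Hence the nonzero structure constants of the basis made of \<open>e\<close> and its dual
  basis are, up to sign, those of \<open>e\<close> with the three indices in another order. For \<open>L\<close> the two
  uniqueness conditions and antisymmetry say that any two of the three indices determine the third,
  and this does not depend on the order.
\<close>

theorem nice_cotangent:
  assumes L: "lie_algebra L" and nice: "nice L"
  shows "nice (cotangent L)"
proof -
  interpret L: plain_lie_algebra L
    by (rule plain_lie_algebra.intro[OF L])
  interpret T: plain_lie_algebra "cotangent L"
    by (rule plain_lie_algebra.intro[OF lie_algebra_cotangent[OF L]])
  obtain n e where ne: "nice_basis L n e"
    using nice by (auto simp: nice_def)
  then have b: "basis L n e"
    by (simp add: nice_basis_def)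
  then have e [simp]: "\<And>i. i < n \<Longrightarrow> e i \<in> carrier L"
    by (simp add: basis_def)
  obtain \<epsilon> where d: "dual_basis L n e \<epsilon>"
    and u1: "\<And>i j k k'. \<lbrakk>i < n; j < n; k < n; k' < n;
      \<epsilon> k (e i \<otimes>\<^bsub>L\<^esub> e j) \<noteq> 0; \<epsilon> k' (e i \<otimes>\<^bsub>L\<^esub> e j) \<noteq> 0\<rbrakk> \<Longrightarrow> k = k'"
    and u2: "\<And>i j j' k. \<lbrakk>i < n; j < n; j' < n; k < n;
      \<epsilon> k (e i \<otimes>\<^bsub>L\<^esub> e j) \<noteq> 0; \<epsilon> k (e i \<otimes>\<^bsub>L\<^esub> e j') \<noteq> 0\<rbrakk> \<Longrightarrow> j = j'"
    using L.nice_basisD[OF ne] by blast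
  have eps [simp]: "\<epsilon> i \<in> carrier (dual_space L)" if "i < n" for i
    using d that by (simp add: dual_basis_def)
  have anti: "\<epsilon> k (e i \<otimes>\<^bsub>L\<^esub> e j) = - \<epsilon> k (e j \<otimes>\<^bsub>L\<^esub> e i)" if "i < n" "j < n" "k < n" for i j k
    using that by (intro L.form_bracket_antisym) auto
  have u3: "i = i'" if "i < n" "i' < n" "j < n" "k < n"
    "\<epsilon> k (e i \<otimes>\<^bsub>L\<^esub> e j) \<noteq> 0" "\<epsilon> k (e i' \<otimes>\<^bsub>L\<^esub> e j) \<noteq> 0" for i i' j k
    using that u2[of j i i' k] anti by (metis neg_equal_0_iff_equal)
  define e' where "e' i = (if i < n then (e i, \<zero>\<^bsub>dual_space L\<^esub>) else (\<zero>\<^bsub>L\<^esub>, \<epsilon> (i - n)))" for i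
  define \<epsilon>' where "\<epsilon>' j = (\<lambda>z\<in>carrier (cotangent L). if j < n then \<epsilon> j (fst z) else snd z (e (j - n)))" for j
  have e': "e' i \<in> carrier (cotangent L)" if "i < n + n" for i
    using that by (auto simp: e'_def cotangent_ops L.zero_form)
  have eps': "\<epsilon>' j \<in> carrier (dual_space (cotangent L))" if "j < n + n" for j
    using that T.a_closed T.smult_in_carrier
    by (subst dual_space_def)
      (auto simp: \<epsilon>'_def cotangent_ops L.form_add[OF eps] L.form_smult[OF eps])
  have d': "dual_basis (cotangent L) (n + n) e' \<epsilon>'"
    unfolding dual_basis_def
  proof (intro conjI allI impI)
    fix i j
    assume ij: "i < n + n" "j < n + n"
    then show "\<epsilon>' j (e' i) = (if i = j then 1 else 0)"
      using d e'[OF ij(1)]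
      by (auto simp: \<epsilon>'_def e'_def dual_basis_def L.zero_form L.form_zero not_less)
  qed (rule eps')
  have T: "\<epsilon>' k (e' i \<otimes>\<^bsub>cotangent L\<^esub> e' j) =
      (if i < n \<and> j < n \<and> k < n then \<epsilon> k (e i \<otimes>\<^bsub>L\<^esub> e j)
       else if i < n \<and> \<not> j < n \<and> \<not> k < n then - \<epsilon> (j - n) (e i \<otimes>\<^bsub>L\<^esub> e (k - n))
       else if \<not> i < n \<and> j < n \<and> \<not> k < n then \<epsilon> (i - n) (e j \<otimes>\<^bsub>L\<^esub> e (k - n))
       else 0)" if "i < n + n" "j < n + n" "k < n + n" for i j k
    using that T.prod_closed[OF e' e']
    by (auto simp: \<epsilon>'_def e'_def cotangent_ops L.prod_closed L.zero_form L.bracket_zero L.form_zero)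
  have "nice_basis (cotangent L) (n + n) e'"
  proof (rule T.nice_basisI[OF e' d'])
    fix z
    assume z: "z \<in> carrier (cotangent L)" "\<And>i. i < n + n \<Longrightarrow> \<epsilon>' i z = 0"
    have 1: "fst z = \<zero>\<^bsub>L\<^esub>"
    proof (rule L.separating_if_basis[OF b d])
      show "fst z \<in> carrier L" using z by (auto simp: cotangent_ops)
      show "\<epsilon> i (fst z) = 0" if "i < n" for i
        using z(1) z(2)[of i] that by (simp add: \<epsilon>'_def)
    qed
    have 2: "snd z = \<zero>\<^bsub>dual_space L\<^esub>"
    proof (rule L.form_eq_on_basis[OF b])
      show "snd z \<in> carrier (dual_space L)" using z by (auto simp: cotangent_ops)
      show "snd z (e i) = \<zero>\<^bsub>dual_space L\<^esub> (e i)" if "i < n" for i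
        using z(1) z(2)[of "i + n"] that by (simp add: \<epsilon>'_def L.zero_form)
    qed (rule L.zero_form)
    from 1 2 show "z = \<zero>\<^bsub>cotangent L\<^esub>"
      by (simp add: cotangent_ops prod_eq_iff)
  next
    fix i j k k'
    assume a: "i < n + n" "j < n + n" "k < n + n" "k' < n + n"
      "\<epsilon>' k (e' i \<otimes>\<^bsub>cotangent L\<^esub> e' j) \<noteq> 0" "\<epsilon>' k' (e' i \<otimes>\<^bsub>cotangent L\<^esub> e' j) \<noteq> 0"
    consider "i < n" "j < n" | "i < n" "\<not> j < n" | "\<not> i < n" "j < n" | "\<not> i < n" "\<not> j < n"
      by blast
    then show "k = k'"
    proof cases
      case 1
      with a show ?thesis by (auto simp: T intro: u1 split: if_splits)
    next
      case 2
      with a have "k - n = k' - n" "\<not> k < n" "\<not> k' < n"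
        by (auto simp: T intro!: u2[of i "k - n" "k' - n" "j - n"] split: if_splits)
      then show ?thesis by simp
    next
      case 3
      with a have "k - n = k' - n" "\<not> k < n" "\<not> k' < n"
        by (auto simp: T intro!: u2[of j "k - n" "k' - n" "i - n"] split: if_splits)
      then show ?thesis by simp
    next
      case 4
      with a show ?thesis by (simp add: T)
    qed
  next
    fix i j j' k
    assume a: "i < n + n" "j < n + n" "j' < n + n" "k < n + n"
      "\<epsilon>' k (e' i \<otimes>\<^bsub>cotangent L\<^esub> e' j) \<noteq> 0" "\<epsilon>' k (e' i \<otimes>\<^bsub>cotangent L\<^esub> e' j') \<noteq> 0"
    consider "i < n" "k < n" | "i < n" "\<not> k < n" | "\<not> i < n" "\<not> k < n" | "\<not> i < n" "k < n"
      by blast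
    then show "j = j'"
    proof cases
      case 1
      with a show ?thesis by (auto simp: T intro: u2 split: if_splits)
    next
      case 2
      with a have "j - n = j' - n" "\<not> j < n" "\<not> j' < n"
        by (auto simp: T intro!: u1[of i "k - n" "j - n" "j' - n"] split: if_splits)
      then show ?thesis by simp
    next
      case 3
      with a show ?thesis
        by (auto simp: T intro!: u3[of j j' "k - n" "i - n"] split: if_splits)
    next
      case 4
      with a show ?thesis by (simp add: T)
    qed
  qed
  then show ?thesis
    by (auto simp: nice_def)
qed

section \<open>Evaluating Lie words by weighted shifts\<close>

text \<open>
  Let the generator \<open>i\<close> act on sequences as the weighted shift with weights \<open>c i\<close>, that is,
  \<open>f \<mapsto> (\<lambda>n. c i n * f (n + 1))\<close>. Brackets act as commutators, so a word \<open>w\<close> acts as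
  \<open>f \<mapsto> (\<lambda>n. lie_weight c w n * f (n + word_degree w))\<close>.
\<close>

fun lie_weight :: "(nat \<Rightarrow> nat \<Rightarrow> real) \<Rightarrow> word \<Rightarrow> nat \<Rightarrow> real" where
  "lie_weight c (Gen i) n = c i n"
| "lie_weight c (Br u v) n =
     lie_weight c u n * lie_weight c v (n + word_degree u) -
     lie_weight c v n * lie_weight c u (n + word_degree v)"

definition shift_op :: "(nat \<Rightarrow> nat \<Rightarrow> real) \<Rightarrow> (word \<Rightarrow> real) \<Rightarrow> (nat \<Rightarrow> real) \<Rightarrow> nat \<Rightarrow> real" where
  "shift_op c p f n = (\<Sum>w | p w \<noteq> 0. p w * lie_weight c w n * f (n + word_degree w))"

lemma word_degree_pos: "word_degree w > 0"
  by (induction w) auto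

lemma carrier_finite: "p \<in> carrier (free_nonassoc m) \<Longrightarrow> finite {w. p w \<noteq> 0}"
  by (simp add: free_nonassoc_def)

lemma shift_op_superset:
  assumes "finite S" "\<And>w. p w \<noteq> 0 \<Longrightarrow> w \<in> S"
  shows "shift_op c p f n = (\<Sum>w\<in>S. p w * lie_weight c w n * f (n + word_degree w))"
  unfolding shift_op_def by (rule sum.mono_neutral_left) (use assms in auto)

lemma shift_op_add:
  assumes "p \<in> carrier (free_nonassoc m)" "q \<in> carrier (free_nonassoc m)"
  shows "shift_op c (p \<oplus>\<^bsub>free_nonassoc m\<^esub> q) f n = shift_op c p f n + shift_op c q f n"
proof -
  let ?S = "{w. p w \<noteq> 0} \<union> {w. q w \<noteq> 0}"
  have S: "finite ?S"
    using assms by (simp add: carrier_finite)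
  have "shift_op c (p \<oplus>\<^bsub>free_nonassoc m\<^esub> q) f n =
      (\<Sum>w\<in>?S. (p w + q w) * lie_weight c w n * f (n + word_degree w))"
    by (subst shift_op_superset[OF S]) (auto simp: free_nonassoc_def)
  also have "\<dots> = shift_op c p f n + shift_op c q f n"
    by (subst (1 2) shift_op_superset[OF S]) (auto simp: algebra_simps sum.distrib)
  finally show ?thesis .
qed

lemma shift_op_smult:
  assumes "p \<in> carrier (free_nonassoc m)"
  shows "shift_op c (a \<odot>\<^bsub>free_nonassoc m\<^esub> p) f n = a * shift_op c p f n"
proof -
  have "shift_op c (a \<odot>\<^bsub>free_nonassoc m\<^esub> p) f n =
      (\<Sum>w | p w \<noteq> 0. a * p w * lie_weight c w n * f (n + word_degree w))"
    by (subst shift_op_superset[OF carrier_finite[OF assms]]) (auto simp: free_nonassoc_def)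
  then show ?thesis
    by (simp add: shift_op_def sum_distrib_left mult.assoc)
qed

lemma shift_op_fun_diff:
  "shift_op c p (\<lambda>k. f k - g k) n = shift_op c p f n - shift_op c p g n"
  by (simp add: shift_op_def algebra_simps sum_subtractf)

lemma shift_op_zero_fun: "shift_op c p (\<lambda>k. 0) n = 0"
  by (simp add: shift_op_def)

lemma shift_op_mult:
  assumes "p \<in> carrier (free_nonassoc m)" "q \<in> carrier (free_nonassoc m)"
  shows "shift_op c (p \<otimes>\<^bsub>free_nonassoc m\<^esub> q) f n =
    shift_op c p (shift_op c q f) n - shift_op c q (shift_op c p f) n"
proof -
  let ?P = "{w. p w \<noteq> 0}" and ?Q = "{w. q w \<noteq> 0}" and ?pq = "p \<otimes>\<^bsub>free_nonassoc m\<^esub> q"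
  let ?g = "lie_weight c" and ?d = word_degree
  have fin: "finite ?P" "finite ?Q"
    using assms by (auto simp: carrier_finite)
  have pq: "?pq (Br u v) = p u * q v" "?pq (Gen i) = 0" for u v i
    by (auto simp: free_nonassoc_def)
  have supp: "w \<in> (\<lambda>(u, v). Br u v) ` (?P \<times> ?Q)" if "?pq w \<noteq> 0" for w
    using that by (cases w) (auto simp: pq)
  have "shift_op c ?pq f n =
      (\<Sum>w\<in>(\<lambda>(u, v). Br u v) ` (?P \<times> ?Q). ?pq w * ?g w n * f (n + ?d w))"
    using fin supp by (intro shift_op_superset) auto
  also have "\<dots> = (\<Sum>(u, v)\<in>?P \<times> ?Q. p u * q v *
      (?g u n * ?g v (n + ?d u) - ?g v n * ?g u (n + ?d v)) * f (n + (?d u + ?d v)))"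
    by (subst sum.reindex) (auto simp: inj_on_def pq intro!: sum.cong)
  also have "\<dots> = (\<Sum>u\<in>?P. \<Sum>v\<in>?Q. p u * ?g u n * (q v * ?g v (n + ?d u) * f (n + ?d u + ?d v))) -
      (\<Sum>u\<in>?P. \<Sum>v\<in>?Q. q v * ?g v n * (p u * ?g u (n + ?d v) * f (n + ?d v + ?d u)))"
    unfolding sum.cartesian_product[symmetric] sum_subtractf[symmetric]
    by (intro sum.cong refl) (auto simp: algebra_simps)
  also have "\<dots> = shift_op c p (shift_op c q f) n - shift_op c q (shift_op c p f) n"
    unfolding shift_op_def sum_distrib_left sum.swap[of _ ?P ?Q] ..
  finally show ?thesis .
qed

text \<open>
  Commutators of operators satisfy the Lie relations, so the action factors over the free Lie
  algebra.
\<close>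

lemma shift_op_lie_ideal:
  assumes "p \<in> lie_ideal m"
  shows "shift_op c p f n = 0"
proof -
  let ?A = "free_nonassoc m"
  interpret A: nonassoc_algebra ?A by (rule nonassoc_algebra_free_nonassoc)
  define K where "K = {p \<in> carrier ?A. \<forall>f n. shift_op c p f n = 0}"
  have K0: "shift_op c \<zero>\<^bsub>?A\<^esub> f n = 0" for f n
    by (simp add: shift_op_def free_nonassoc_def)
  have mult_fun: "shift_op c (p \<otimes>\<^bsub>?A\<^esub> q) f =
      (\<lambda>n. shift_op c p (shift_op c q f) n - shift_op c q (shift_op c p f) n)"
    if "p \<in> carrier ?A" "q \<in> carrier ?A" for p q f
    using shift_op_mult[OF that] by blast
  have Kz: "shift_op c p f = (\<lambda>k. 0)" if "p \<in> K" for p f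
    using that by (auto simp: K_def)
  have "submodule K real_ring ?A"
  proof (rule A.submoduleI)
    show "\<ominus>\<^bsub>?A\<^esub> a \<in> K" if "a \<in> K" for a
    proof -
      have a: "a \<in> carrier ?A" using that by (simp add: K_def)
      have "0 = shift_op c (\<ominus>\<^bsub>?A\<^esub> a \<oplus>\<^bsub>?A\<^esub> a) f n" for f n
        using a K0 by (simp add: A.l_neg)
      also have "shift_op c (\<ominus>\<^bsub>?A\<^esub> a \<oplus>\<^bsub>?A\<^esub> a) f n = shift_op c (\<ominus>\<^bsub>?A\<^esub> a) f n" for f n
        using that a by (subst shift_op_add) (auto simp: K_def)
      finally show ?thesis
        using a by (simp add: K_def)
    qed
  qed (auto simp: K_def K0 shift_op_add shift_op_smult)
  moreover have "x \<otimes>\<^bsub>?A\<^esub> i \<in> K \<and> i \<otimes>\<^bsub>?A\<^esub> x \<in> K" if "x \<in> carrier ?A" "i \<in> K" for x i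
    using that Kz[OF that(2)]
    by (simp add: K_def A.prod_closed shift_op_mult shift_op_zero_fun)
  ultimately have "alg_ideal K ?A"
    by (simp add: alg_ideal_def)
  moreover have "lie_relations ?A \<subseteq> K"
    by (auto simp: lie_relations_def K_def A.prod_closed shift_op_add mult_fun shift_op_fun_diff)
  ultimately have "lie_ideal m \<subseteq> K"
    unfolding lie_ideal_def gen_alg_ideal_def by blast
  then show ?thesis
    using assms by (auto simp: K_def)
qed

text \<open>
  In the matrix picture: \<open>T\<close> vanishes below its \<open>d\<close>-th superdiagonal, on which it has the entries
  \<open>l\<close>. The lowest superdiagonal of a product depends only on those of the factors.
\<close>

definition leading :: "((nat \<Rightarrow> real) \<Rightarrow> nat \<Rightarrow> real) \<Rightarrow> nat \<Rightarrow> (nat \<Rightarrow> real) \<Rightarrow> bool" where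
  "leading T d l \<longleftrightarrow> (\<forall>f K t. (\<forall>k>K + d. f k = 0) \<and> f (K + d) = t \<longrightarrow>
     (\<forall>k>K. T f k = 0) \<and> T f K = l K * t)"

lemma leading_shift_op:
  assumes p: "p \<in> carrier (free_nonassoc m)"
  shows "leading (shift_op c p) 1 (\<lambda>n. \<Sum>i<m. p (Gen i) * c i n)"
  unfolding leading_def
proof (intro allI impI conjI)
  fix f :: "nat \<Rightarrow> real" and K t
  assume f: "(\<forall>k>K + 1. f k = 0) \<and> f (K + 1) = t"
  show "shift_op c p f k = 0" if "k > K" for k
    unfolding shift_op_def
  proof (rule sum.neutral, intro ballI)
    fix w
    have "k + word_degree w > K + 1"
      using that word_degree_pos[of w] by linarith
    then show "p w * lie_weight c w k * f (k + word_degree w) = 0"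
      using f by simp
  qed
  let ?S = "{w. p w \<noteq> 0} \<union> Gen ` {..<m}"
  have S: "finite ?S"
    using p by (simp add: carrier_finite)
  have z: "p w * lie_weight c w K * f (K + word_degree w) = 0" if w: "w \<in> ?S - Gen ` {..<m}" for w
  proof (cases w)
    case (Gen i)
    then have "p (Gen i) = 0"
      using w p by (auto simp: free_nonassoc_def)
    with Gen show ?thesis by simp
  next
    case (Br u v)
    then show ?thesis
      using f word_degree_pos[of u] word_degree_pos[of v] by simp
  qed
  have "shift_op c p f K = (\<Sum>w\<in>?S. p w * lie_weight c w K * f (K + word_degree w))"
    using S by (rule shift_op_superset) auto
  also have "\<dots> = (\<Sum>w\<in>Gen ` {..<m}. p w * lie_weight c w K * f (K + word_degree w))"
    using S z by (intro sum.mono_neutral_right) auto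
  also have "\<dots> = (\<Sum>i<m. p (Gen i) * c i K) * t"
    using f by (subst sum.reindex) (auto simp: inj_on_def sum_distrib_right)
  finally show "shift_op c p f K = (\<Sum>i<m. p (Gen i) * c i K) * t" .
qed

fun word_eval :: "(real, 'a) module \<Rightarrow> (nat \<Rightarrow> 'a) \<Rightarrow> word \<Rightarrow> 'a" where
  "word_eval A b (Gen i) = b i"
| "word_eval A b (Br u v) = word_eval A b u \<otimes>\<^bsub>A\<^esub> word_eval A b v"

text \<open>
  Terms of degree greater than 1 in the \<open>p i\<close> affect only higher superdiagonals. So the leading term
  of a bracket word in the \<open>p i\<close> is that of the same word in shifts with new weights, the values of
  the linear parts of the \<open>p i\<close>.
\<close>

lemma leading_word_eval:
  assumes "\<And>i. i \<in> gens w \<Longrightarrow> p i \<in> carrier (free_nonassoc m)"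
  shows "word_eval (free_nonassoc m) p w \<in> carrier (free_nonassoc m) \<and>
    leading (shift_op c (word_eval (free_nonassoc m) p w)) (word_degree w)
      (lie_weight (\<lambda>i n. \<Sum>j<m. p i (Gen j) * c j n) w)"
  using assms
proof (induction w)
  case (Gen i)
  then show ?case
    using leading_shift_op[of "p i" m c] by simp
next
  case (Br u v)
  interpret A: nonassoc_algebra "free_nonassoc m" by (rule nonassoc_algebra_free_nonassoc)
  let ?u = "word_eval (free_nonassoc m) p u" and ?v = "word_eval (free_nonassoc m) p v"
  let ?g = "lie_weight (\<lambda>i n. \<Sum>j<m. p i (Gen j) * c j n)"
  have cl: "?u \<in> carrier (free_nonassoc m)" "?v \<in> carrier (free_nonassoc m)"
    and lu: "leading (shift_op c ?u) (word_degree u) (?g u)"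
    and lv: "leading (shift_op c ?v) (word_degree v) (?g v)"
    using Br by auto
  have "leading (shift_op c (word_eval (free_nonassoc m) p (Br u v)))
      (word_degree (Br u v)) (?g (Br u v))"
    unfolding leading_def
  proof (intro allI impI)
    fix f :: "nat \<Rightarrow> real" and K t
    assume "(\<forall>k>K + word_degree (Br u v). f k = 0) \<and> f (K + word_degree (Br u v)) = t"
    then have f: "(\<forall>k>K + word_degree u + word_degree v. f k = 0) \<and> f (K + word_degree u + word_degree v) = t"
        "(\<forall>k>K + word_degree v + word_degree u. f k = 0) \<and> f (K + word_degree v + word_degree u) = t"
      by (simp_all add: ac_simps)
    have "(\<forall>k>K + word_degree u. shift_op c ?v f k = 0) \<and>
        shift_op c ?v f (K + word_degree u) = ?g v (K + word_degree u) * t"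
      using lv f(1) unfolding leading_def by blast
    then have 1: "(\<forall>k>K. shift_op c ?u (shift_op c ?v f) k = 0) \<and>
        shift_op c ?u (shift_op c ?v f) K = ?g u K * (?g v (K + word_degree u) * t)"
      using lu unfolding leading_def by blast
    have "(\<forall>k>K + word_degree v. shift_op c ?u f k = 0) \<and>
        shift_op c ?u f (K + word_degree v) = ?g u (K + word_degree v) * t"
      using lu f(2) unfolding leading_def by blast
    then have 2: "(\<forall>k>K. shift_op c ?v (shift_op c ?u f) k = 0) \<and>
        shift_op c ?v (shift_op c ?u f) K = ?g v K * (?g u (K + word_degree v) * t)"
      using lv unfolding leading_def by blast
    show "(\<forall>k>K. shift_op c (word_eval (free_nonassoc m) p (Br u v)) f k = 0) \<and>
        shift_op c (word_eval (free_nonassoc m) p (Br u v)) f K = ?g (Br u v) K * t"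
      using 1 2 by (simp add: shift_op_mult[OF cl] algebra_simps)
  qed
  then show ?case
    using A.prod_closed[OF cl] by (simp del: lie_weight.simps)
qed

section \<open>Coefficient forms on free nilpotent Lie algebras\<close>

definition nilp_class :: "nat \<Rightarrow> nat \<Rightarrow> (word \<Rightarrow> real) \<Rightarrow> (word \<Rightarrow> real) set set" where
  "nilp_class m s p = degree_gt m s +>\<^bsub>free_lie m\<^esub> (lie_ideal m +>\<^bsub>free_nonassoc m\<^esub> p)"

context
  fixes m s :: nat
begin

private lemmas quot_lie =
  quot_facts[OF nonassoc_algebra_free_nonassoc lie_ideal_facts(1)[of m], folded free_lie_def]

private lemmas quot_nilp =
  quot_facts[OF lie_algebra.axioms(1)[OF lie_algebra_free_lie] degree_gt_ideal[of m s],
    folded free_nilpotent_def]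

lemma nilp_class_image:
  "carrier (free_nilpotent m s) = nilp_class m s ` carrier (free_nonassoc m)"
  by (auto simp: nilp_class_def quot_nilp(1) quot_lie(1) image_image)

lemma nilp_class_ops:
  assumes "p \<in> carrier (free_nonassoc m)" "q \<in> carrier (free_nonassoc m)"
  shows "nilp_class m s (p \<oplus>\<^bsub>free_nonassoc m\<^esub> q) =
      nilp_class m s p \<oplus>\<^bsub>free_nilpotent m s\<^esub> nilp_class m s q"
    and "nilp_class m s (p \<otimes>\<^bsub>free_nonassoc m\<^esub> q) =
      nilp_class m s p \<otimes>\<^bsub>free_nilpotent m s\<^esub> nilp_class m s q"
    and "nilp_class m s (a \<odot>\<^bsub>free_nonassoc m\<^esub> p) = a \<odot>\<^bsub>free_nilpotent m s\<^esub> nilp_class m s p"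
  using assms by (simp_all add: nilp_class_def quot_nilp quot_lie)

lemma nilp_class_eq_zero_iff:
  assumes "p \<in> carrier (free_nonassoc m)"
  shows "nilp_class m s p = \<zero>\<^bsub>free_nilpotent m s\<^esub> \<longleftrightarrow> (\<exists>q \<in> carrier (free_nonassoc m).
    (\<forall>w. q w \<noteq> 0 \<longrightarrow> word_degree w > s) \<and> p \<ominus>\<^bsub>free_nonassoc m\<^esub> q \<in> lie_ideal m)"
proof -
  let ?A = "free_nonassoc m"
  interpret A: plain_algebra ?A
    by (rule plain_algebra.intro) (rule nonassoc_algebra_free_nonassoc)
  interpret L: lie_algebra "free_lie m" by (rule lie_algebra_free_lie)
  have eq: "lie_ideal m +>\<^bsub>?A\<^esub> p = lie_ideal m +>\<^bsub>?A\<^esub> q \<longleftrightarrow> p \<ominus>\<^bsub>?A\<^esub> q \<in> lie_ideal m"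
    if q: "q \<in> carrier ?A" for q
  proof -
    let ?c = "\<lambda>p. lie_ideal m +>\<^bsub>?A\<^esub> p"
    have cl: "?c p \<in> carrier (free_lie m)" "?c q \<in> carrier (free_lie m)"
      "?c (\<ominus>\<^bsub>?A\<^esub> q) \<in> carrier (free_lie m)"
      using assms q by (simp_all add: quot_lie)
    have neg: "?c q \<oplus>\<^bsub>free_lie m\<^esub> ?c (\<ominus>\<^bsub>?A\<^esub> q) = \<zero>\<^bsub>free_lie m\<^esub>"
      using q by (simp add: quot_lie A.r_neg)
    have "p \<ominus>\<^bsub>?A\<^esub> q \<in> lie_ideal m \<longleftrightarrow> ?c p \<oplus>\<^bsub>free_lie m\<^esub> ?c (\<ominus>\<^bsub>?A\<^esub> q) = \<zero>\<^bsub>free_lie m\<^esub>"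
      using quot_lie(6)[of "p \<ominus>\<^bsub>?A\<^esub> q"] assms q by (simp add: quot_lie(2,5) a_minus_def)
    also have "\<dots> \<longleftrightarrow> ?c p = ?c q"
      using cl neg by (metis L.add.inv_unique L.a_comm L.minus_equality L.add.inv_inv)
    finally show ?thesis by simp
  qed
  have "nilp_class m s p = \<zero>\<^bsub>free_nilpotent m s\<^esub> \<longleftrightarrow> lie_ideal m +>\<^bsub>?A\<^esub> p \<in> degree_gt m s"
    using quot_nilp(6)[of "lie_ideal m +>\<^bsub>?A\<^esub> p"] assms
    by (simp add: nilp_class_def quot_nilp(5) quot_lie(1))
  then show ?thesis
    using eq by (auto simp: degree_gt_def)
qed

end

text \<open>
  The entry \<open>(0, d)\<close> of the matrix of the operator of \<open>p\<close>, for any representative \<open>p\<close>: words of degree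
  greater than \<open>s\<close> contribute only beyond the \<open>s\<close>-th superdiagonal, so the choice is irrelevant if
  \<open>d \<le> s\<close>. For \<open>c i n = of_bool (W n = i)\<close> the entry is the coefficient of the monomial
  \<open>W 0 W 1 \<dots> W (d - 1)\<close> in the expansion of \<open>p\<close> in the free associative algebra.
\<close>

definition coeff_form ::
    "nat \<Rightarrow> nat \<Rightarrow> (nat \<Rightarrow> nat \<Rightarrow> real) \<Rightarrow> nat \<Rightarrow> (word \<Rightarrow> real) set set \<Rightarrow> real" where
  "coeff_form m s c d = (\<lambda>x\<in>carrier (free_nilpotent m s).
     shift_op c (SOME p. p \<in> carrier (free_nonassoc m) \<and> nilp_class m s p = x)
       (\<lambda>k. of_bool (k = d)) 0)"

lemma coeff_form_class:
  assumes d: "d \<le> s" and p: "p \<in> carrier (free_nonassoc m)"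
  shows "coeff_form m s c d (nilp_class m s p) = shift_op c p (\<lambda>k. of_bool (k = d)) 0"
proof -
  let ?A = "free_nonassoc m" and ?N = "free_nilpotent m s" and ?f = "\<lambda>k. of_bool (k = d)"
  interpret A: plain_algebra ?A
    by (rule plain_algebra.intro) (rule nonassoc_algebra_free_nonassoc)
  interpret N: plain_lie_algebra ?N
    by (rule plain_lie_algebra.intro) (rule lie_algebra_free_nilpotent)
  define p' where "p' = (SOME q. q \<in> carrier ?A \<and> nilp_class m s q = nilp_class m s p)"
  have p': "p' \<in> carrier ?A" "nilp_class m s p' = nilp_class m s p"
    using someI[of "\<lambda>q. q \<in> carrier ?A \<and> nilp_class m s q = nilp_class m s p" p] p
    by (auto simp: p'_def)
  let ?r = "p' \<oplus>\<^bsub>?A\<^esub> (-1) \<odot>\<^bsub>?A\<^esub> p"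
  have r: "?r \<in> carrier ?A"
    using p p' by simp
  have "nilp_class m s ?r = nilp_class m s p \<oplus>\<^bsub>?N\<^esub> (-1) \<odot>\<^bsub>?N\<^esub> nilp_class m s p"
    using p p' by (simp add: nilp_class_ops)
  also have "\<dots> = (1 + (-1)) \<odot>\<^bsub>?N\<^esub> nilp_class m s p"
    using p N.smult_l_distr[of 1 "-1" "nilp_class m s p"] N.smult_one
    by (simp add: nilp_class_image)
  also have "\<dots> = \<zero>\<^bsub>?N\<^esub>"
    using p N.zero_smult by (simp add: nilp_class_image)
  finally obtain q where q: "q \<in> carrier ?A" "\<forall>w. q w \<noteq> 0 \<longrightarrow> word_degree w > s"
      "?r \<ominus>\<^bsub>?A\<^esub> q \<in> lie_ideal m"
    using nilp_class_eq_zero_iff[OF r, of s] by blast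
  have "?r = (?r \<ominus>\<^bsub>?A\<^esub> q) \<oplus>\<^bsub>?A\<^esub> q"
    using q r by (simp add: a_minus_def A.a_assoc A.l_neg del: A.a_closed)
  then have "shift_op c ?r ?f 0 = shift_op c (?r \<ominus>\<^bsub>?A\<^esub> q) ?f 0 + shift_op c q ?f 0"
    using q r shift_op_add[of "?r \<ominus>\<^bsub>?A\<^esub> q" m q c ?f 0] by simp
  also have "shift_op c q ?f 0 = 0"
    unfolding shift_op_def using q(2) d by (intro sum.neutral) auto
  also have "shift_op c (?r \<ominus>\<^bsub>?A\<^esub> q) ?f 0 = 0"
    using q(3) by (rule shift_op_lie_ideal)
  also have "shift_op c ?r ?f 0 = shift_op c p' ?f 0 - shift_op c p ?f 0"
    using p p' by (simp add: shift_op_add shift_op_smult)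
  finally show ?thesis
    using p by (simp add: coeff_form_def p'_def[symmetric] nilp_class_image)
qed

lemma coeff_form_in_dual:
  assumes "d \<le> s"
  shows "coeff_form m s c d \<in> carrier (dual_space (free_nilpotent m s))"
proof -
  interpret A: plain_algebra "free_nonassoc m"
    by (rule plain_algebra.intro) (rule nonassoc_algebra_free_nonassoc)
  let ?N = "free_nilpotent m s"
  have "coeff_form m s c d (x \<oplus>\<^bsub>?N\<^esub> y) = coeff_form m s c d x + coeff_form m s c d y"
    if x: "x \<in> carrier ?N" and y: "y \<in> carrier ?N" for x y
  proof -
    obtain p where "p \<in> carrier (free_nonassoc m)" "x = nilp_class m s p"
      using x unfolding nilp_class_image by (rule imageE)
    moreover obtain q where "q \<in> carrier (free_nonassoc m)" "y = nilp_class m s q"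
      using y unfolding nilp_class_image by (rule imageE)
    ultimately show ?thesis
      using coeff_form_class[OF assms] by (simp add: nilp_class_ops[symmetric] shift_op_add)
  qed
  moreover have "coeff_form m s c d (a \<odot>\<^bsub>?N\<^esub> x) = a * coeff_form m s c d x"
    if x: "x \<in> carrier ?N" for a x
  proof -
    obtain p where "p \<in> carrier (free_nonassoc m)" "x = nilp_class m s p"
      using x unfolding nilp_class_image by (rule imageE)
    then show ?thesis
      using coeff_form_class[OF assms] by (simp add: nilp_class_ops[symmetric] shift_op_smult)
  qed
  ultimately show ?thesis
    by (auto simp: dual_space_def coeff_form_def)
qed

lemma nilp_class_word_eval:
  assumes "\<And>i. i \<in> gens w \<Longrightarrow> p i \<in> carrier (free_nonassoc m)"
  shows "nilp_class m s (word_eval (free_nonassoc m) p w) =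
    word_eval (free_nilpotent m s) (\<lambda>i. nilp_class m s (p i)) w"
  using assms
proof (induction w)
  case (Br u v)
  then show ?case
    using leading_word_eval[of u p m] leading_word_eval[of v p m] by (simp add: nilp_class_ops)
qed simp

lemma coeff_form_word_eval:
  assumes "word_degree w \<le> s" "\<And>i. i \<in> gens w \<Longrightarrow> p i \<in> carrier (free_nonassoc m)"
  shows "coeff_form m s c (word_degree w)
      (word_eval (free_nilpotent m s) (\<lambda>i. nilp_class m s (p i)) w) =
    lie_weight (\<lambda>i n. \<Sum>j<m. p i (Gen j) * c j n) w 0"
proof -
  let ?f = "\<lambda>k. of_bool (k = word_degree w) :: real"
  let ?q = "word_eval (free_nonassoc m) p w"
  have q: "?q \<in> carrier (free_nonassoc m)" "leading (shift_op c ?q) (word_degree w)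
      (lie_weight (\<lambda>i n. \<Sum>j<m. p i (Gen j) * c j n) w)"
    using leading_word_eval[OF assms(2)] by auto
  have "shift_op c ?q ?f 0 = lie_weight (\<lambda>i n. \<Sum>j<m. p i (Gen j) * c j n) w 0 * 1"
    using q(2)[unfolded leading_def, rule_format, of 0 ?f 1] by simp
  then show ?thesis
    using coeff_form_class[OF assms(1) q(1)] nilp_class_word_eval[OF assms(2)] by simp
qed

lemma lie_weight_cong:
  assumes "\<And>i k. i \<in> gens w \<Longrightarrow> c i k = c' i k"
  shows "lie_weight c w n = lie_weight c' w n"
  using assms by (induction w arbitrary: n) auto

section \<open>Surjections onto free nilpotent Lie algebras\<close>

text \<open>
  If the rows of a matrix span, then some \<open>k\<close> of its rows have a system of dual vectors. To enlarge
  a dual system, consider the \<open>m\<close> forms obtained from the coordinates by subtracting their part in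
  the span of the \<open>a p\<close>: they vanish on the rows already chosen, and not all of them
  are zero because, as a matrix, they have trace \<open>m - k\<close>.
\<close>

lemma dual_system_exists:
  fixes V :: "nat \<Rightarrow> nat \<Rightarrow> real"
  assumes span: "\<And>r j. \<lbrakk>\<forall>i<n. (\<Sum>j<m. V i j * r j) = 0; j < m\<rbrakk> \<Longrightarrow> r j = 0"
    and "k \<le> m"
  shows "\<exists>\<iota> a. (\<forall>p<k. \<iota> p < n) \<and>
    (\<forall>p<k. \<forall>q<k. (\<Sum>j<m. V (\<iota> p) j * a q j) = of_bool (p = q))"
  using \<open>k \<le> m\<close>
proof (induction k)
  case (Suc k)
  then have "\<exists>\<iota> a. (\<forall>p<k. \<iota> p < n) \<and>
      (\<forall>p<k. \<forall>q<k. (\<Sum>j<m. V (\<iota> p) j * a q j) = of_bool (p = q))"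
    by simp
  then obtain \<iota> a where \<iota>: "\<forall>p<k. \<iota> p < n"
    and "\<forall>p<k. \<forall>q<k. (\<Sum>j<m. V (\<iota> p) j * a q j) = of_bool (p = q)"
    by blast
  then have dual: "(\<Sum>j<m. V (\<iota> p) j * a q j) = of_bool (p = q)" if "p < k" "q < k" for p q
    using that by blast
  define r where "r j l = of_bool (l = j) - (\<Sum>p<k. V (\<iota> p) j * a p l)" for j l
  have ev: "(\<Sum>l<m. v l * r j l) = v j - (\<Sum>p<k. V (\<iota> p) j * (\<Sum>l<m. v l * a p l))"
    if "j < m" for v :: "nat \<Rightarrow> real" and j
  proof -
    have "(\<Sum>l<m. v l * r j l) = (\<Sum>l<m. v l * of_bool (l = j)) - (\<Sum>l<m. \<Sum>p<k. V (\<iota> p) j * (v l * a p l))"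
      by (simp add: r_def algebra_simps sum_subtractf sum_distrib_left)
    also have "(\<Sum>l<m. v l * of_bool (l = j)) = v j"
      using that by (simp add: of_bool_def if_distrib cong: if_cong)
    also have "(\<Sum>l<m. \<Sum>p<k. V (\<iota> p) j * (v l * a p l)) = (\<Sum>p<k. V (\<iota> p) j * (\<Sum>l<m. v l * a p l))"
      unfolding sum_distrib_left by (rule sum.swap)
    finally show ?thesis .
  qed
  have r0: "(\<Sum>l<m. V (\<iota> q) l * r j l) = 0" if "j < m" "q < k" for j q
    using that by (subst ev) (auto simp: dual of_bool_def if_distrib cong: if_cong)
  have "(\<Sum>j<m. r j j) = real m - (\<Sum>j<m. \<Sum>p<k. V (\<iota> p) j * a p j)"
    by (simp add: r_def sum_subtractf)
  also have "(\<Sum>j<m. \<Sum>p<k. V (\<iota> p) j * a p j) = (\<Sum>p<k. \<Sum>j<m. V (\<iota> p) j * a p j)"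
    by (rule sum.swap)
  also have "\<dots> = real k"
    by (simp add: dual)
  finally have "(\<Sum>j<m. r j j) \<noteq> 0"
    using Suc.prems by simp
  then obtain j where j: "j < m" "r j j \<noteq> 0"
    by (metis (no_types, lifting) lessThan_iff sum.neutral)
  then obtain i where i: "i < n" "(\<Sum>l<m. V i l * r j l) \<noteq> 0"
    using span[of "r j" j] by blast
  define \<rho> where "\<rho> = (\<Sum>l<m. V i l * r j l)"
  define b where "b q l = (if q = k then r j l / \<rho>
    else a q l - (\<Sum>l<m. V i l * a q l) * (r j l / \<rho>))" for q l
  have bk: "(\<Sum>l<m. v l * b k l) = (\<Sum>l<m. v l * r j l) / \<rho>" for v :: "nat \<Rightarrow> real"
    by (simp add: b_def sum_divide_distrib)
  have bq: "(\<Sum>l<m. v l * b q l) =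
      (\<Sum>l<m. v l * a q l) - (\<Sum>l<m. V i l * a q l) * ((\<Sum>l<m. v l * r j l) / \<rho>)"
    if "q < k" for v :: "nat \<Rightarrow> real" and q
  proof -
    have "v l * b q l = v l * a q l - (\<Sum>l<m. V i l * a q l) * (v l * r j l / \<rho>)" for l
      using that by (simp add: b_def algebra_simps)
    then show ?thesis
      by (simp add: sum_subtractf sum_distrib_left sum_divide_distrib)
  qed
  define \<kappa> where "\<kappa> p = (if p = k then i else \<iota> p)" for p
  have "(\<Sum>l<m. V (\<kappa> p) l * b q l) = of_bool (p = q)" if "p < Suc k" "q < Suc k" for p q
  proof -
    have p: "p = k \<or> p < k" and q: "q = k \<or> q < k"
      using that by auto
    have "(\<Sum>l<m. V i l * b q l) = of_bool (q = k)"
      using q bk[of "V i"] bq[of q "V i"] i(2) by (auto simp: \<rho>_def[symmetric])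
    moreover have "(\<Sum>l<m. V (\<iota> p) l * b q l) = of_bool (p = q)" if "p < k"
      using q bk[of "V (\<iota> p)"] bq[of q "V (\<iota> p)"] r0[OF j(1) that] dual[OF that] that by auto
    ultimately show ?thesis
      using p by (auto simp: \<kappa>_def)
  qed
  moreover have "\<forall>p<Suc k. \<kappa> p < n"
    using i \<iota> by (simp add: \<kappa>_def less_Suc_eq)
  ultimately show ?case
    by blast
qed simp

context plain_lie_algebra
begin

lemma nice_basis_bracket_multiple:
  assumes ne: "nice_basis L n e"
    and x: "\<exists>i<n. \<exists>c. x = c \<odot> e i" and y: "\<exists>i<n. \<exists>c. y = c \<odot> e i"
  shows "\<exists>i<n. \<exists>c. x \<otimes> y = c \<odot> e i"
proof -
  have e: "\<And>i. i < n \<Longrightarrow> e i \<in> carrier L"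
    using ne by (simp add: nice_basis_def basis_def)
  obtain i j c d where ij: "i < n" "j < n" "x = c \<odot> e i" "y = d \<odot> e j"
    using x y by blast
  obtain k a where k: "k < n" "e i \<otimes> e j = a \<odot> e k"
    using ne ij(1,2) unfolding nice_basis_def by blast
  have "x \<otimes> y = d \<odot> (c \<odot> (a \<odot> e k))"
    using ij k e by (simp add: prod_smult_left prod_smult_right)
  also have "\<dots> = (d * c * a) \<odot> e k"
    using k e smult_assoc1[of d "c * a" "e k"] smult_assoc1[of c a "e k"] by (simp add: mult.assoc)
  finally show ?thesis
    using k(1) by blast
qed

text \<open>
  The three terms of the Jacobi identity are multiples of basis vectors with sum zero, so any two
  nonzero ones among them are proportional. The form \<open>f\<close> separates the first term from the second,
  and then also from the third.
\<close>

lemma nice_basis_jacobi_terms: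
  assumes ne: "nice_basis L n e"
    and x: "\<exists>i<n. \<exists>c. x = c \<odot> e i" and y: "\<exists>i<n. \<exists>c. y = c \<odot> e i" and z: "\<exists>i<n. \<exists>c. z = c \<odot> e i"
    and f: "f \<in> carrier (dual_space L)" "f (x \<otimes> (y \<otimes> z)) = 0" "f (y \<otimes> (z \<otimes> x)) \<noteq> 0"
  shows "x \<otimes> (y \<otimes> z) = \<zero>"
proof -
  have e: "\<And>i. i < n \<Longrightarrow> e i \<in> carrier L"
    using ne by (simp add: nice_basis_def basis_def)
  obtain \<epsilon> where d: "dual_basis L n e \<epsilon>"
    using ne by (auto simp: nice_basis_def)
  note br = nice_basis_bracket_multiple[OF ne]
  obtain i1 c1 where u: "i1 < n" "x \<otimes> (y \<otimes> z) = c1 \<odot> e i1"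
    using br[OF x br[OF y z]] by blast
  obtain i2 c2 where v: "i2 < n" "y \<otimes> (z \<otimes> x) = c2 \<odot> e i2"
    using br[OF y br[OF z x]] by blast
  obtain i3 c3 where w: "i3 < n" "z \<otimes> (x \<otimes> y) = c3 \<odot> e i3"
    using br[OF z br[OF x y]] by blast
  have xyz: "x \<in> carrier L" "y \<in> carrier L" "z \<in> carrier L"
    using x y z e by auto
  have form: "c1 * \<phi> (e i1) + c2 * \<phi> (e i2) + c3 * \<phi> (e i3) = 0"
    if \<phi>: "\<phi> \<in> carrier (dual_space L)" for \<phi>
  proof -
    have "\<phi> (c1 \<odot> e i1 \<oplus> c2 \<odot> e i2 \<oplus> c3 \<odot> e i3) = 0"
      using jacobi[OF xyz] form_zero[OF \<phi>] unfolding u v w by simp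
    then show ?thesis
      using u v w e by (simp add: form_add[OF \<phi>] form_smult[OF \<phi>])
  qed
  have f12: "c1 * f (e i1) = 0" "c2 * f (e i2) \<noteq> 0"
    using f(2,3) u v e by (simp_all add: form_smult[OF f(1)])
  then have f3: "c3 * f (e i3) \<noteq> 0"
    using form[OF f(1)] by linarith
  have "c1 = 0"
  proof (rule ccontr)
    assume "c1 \<noteq> 0"
    with f12 f3 have "i2 \<noteq> i1" "i3 \<noteq> i1"
      by auto
    then show False
      using form[of "\<epsilon> i1"] d u v w \<open>c1 \<noteq> 0\<close> by (simp add: dual_basis_def)
  qed
  then show ?thesis
    using u e by (simp add: zero_smult)
qed

lemma word_eval_closed:
  assumes "\<And>i. i \<in> gens w \<Longrightarrow> b i \<in> carrier L"
  shows "word_eval L b w \<in> carrier L"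
  using assms by (induction w) (auto simp: prod_closed)

lemma nice_basis_word_eval_multiple:
  assumes "nice_basis L n e" "\<And>i. i \<in> gens w \<Longrightarrow> \<iota> i < n"
  shows "\<exists>i<n. \<exists>c. word_eval L (\<lambda>i. e (\<iota> i)) w = c \<odot> e i"
  using assms(2)
proof (induction w)
  case (Gen i)
  then show ?case
    using assms(1) smult_one by (metis basis_def gens.simps(1) nice_basis_def singletonI word_eval.simps(1))
next
  case (Br u v)
  then show ?case
    using nice_basis_bracket_multiple[OF assms(1)] by simp
qed

end

text \<open>
  In a nice basis of \<open>L\<close> choose vectors whose images have linearly independent linear parts. A
  coefficient form adapted to these linear parts takes on a bracket word in the chosen vectors the
  value that the coefficient of a monomial takes on the same word in the generators. Hence the
  Jacobi identity of the chosen vectors contradicts niceness as soon as free Lie algebras contain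
  one with pairwise independent terms. This happens for the three generators \<open>x, y, z\<close>, and for
  \<open>x, y, [x, [x, y]]\<close> with only two generators, in degree 5.
\<close>

theorem nonnice_if_onto_free_nilpotent:
  fixes L :: "(real, 'a) module" and \<pi>
  assumes L: "lie_algebra L"
    and hom_add: "\<And>x y. \<lbrakk>x \<in> carrier L; y \<in> carrier L\<rbrakk> \<Longrightarrow>
      \<pi> (x \<oplus>\<^bsub>L\<^esub> y) = \<pi> x \<oplus>\<^bsub>free_nilpotent m s\<^esub> \<pi> y"
    and hom_smult: "\<And>c x. x \<in> carrier L \<Longrightarrow> \<pi> (c \<odot>\<^bsub>L\<^esub> x) = c \<odot>\<^bsub>free_nilpotent m s\<^esub> \<pi> x"
    and hom_mult: "\<And>x y. \<lbrakk>x \<in> carrier L; y \<in> carrier L\<rbrakk> \<Longrightarrow>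
      \<pi> (x \<otimes>\<^bsub>L\<^esub> y) = \<pi> x \<otimes>\<^bsub>free_nilpotent m s\<^esub> \<pi> y"
    and onto: "\<pi> ` carrier L = carrier (free_nilpotent m s)"
    and ms: "(m = 2 \<and> s \<ge> 5) \<or> (m \<ge> 3 \<and> s \<ge> 3)"
  shows "nonnice L"
  unfolding nonnice_def nice_def
proof (intro notI, elim exE)
  fix n e
  assume ne: "nice_basis L n e"
  let ?N = "free_nilpotent m s" and ?A = "free_nonassoc m"
  interpret L: plain_lie_algebra L
    by (rule plain_lie_algebra.intro[OF L])
  interpret N: plain_lie_algebra ?N
    by (rule plain_lie_algebra.intro) (rule lie_algebra_free_nilpotent)
  have b: "basis L n e" and e: "\<And>i. i < n \<Longrightarrow> e i \<in> carrier L"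
    using ne by (simp_all add: nice_basis_def basis_def)
  define F where "F c d = (\<lambda>x\<in>carrier L. coeff_form m s c d (\<pi> x))" for c d
  have F: "F c d \<in> carrier (dual_space L)" if "d \<le> s" for c d
  proof -
    have "\<pi> x \<in> carrier ?N" if "x \<in> carrier L" for x
      using onto that by blast
    then show ?thesis
      using N.form_add[OF coeff_form_in_dual[OF that]] N.form_smult[OF coeff_form_in_dual[OF that]]
      by (subst dual_space_def) (auto simp: F_def hom_add hom_smult)
  qed
  have "\<forall>i. \<exists>p. i < n \<longrightarrow> p \<in> carrier ?A \<and> nilp_class m s p = \<pi> (e i)"
    using onto e nilp_class_image[of m s] by (metis (no_types, lifting) image_iff)
  then obtain p where p: "\<And>i. i < n \<Longrightarrow> p i \<in> carrier ?A"
      "\<And>i. i < n \<Longrightarrow> nilp_class m s (p i) = \<pi> (e i)"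
    by metis
  have \<pi>_word: "\<pi> (word_eval L v w) = word_eval ?N (\<lambda>i. \<pi> (v i)) w"
    if "\<And>i. i \<in> gens w \<Longrightarrow> v i \<in> carrier L" for v w
    using that by (induction w) (simp_all add: hom_mult L.word_eval_closed)
  have word_cong: "word_eval ?N v w = word_eval ?N v' w" if "\<And>i. i \<in> gens w \<Longrightarrow> v i = v' i" for v v' w
    using that by (induction w) auto
  have F_word: "F c (word_degree w) (word_eval L (\<lambda>i. e (\<iota> i)) w) =
      lie_weight (\<lambda>i k. \<Sum>j<m. p (\<iota> i) (Gen j) * c j k) w 0"
    if "word_degree w \<le> s" "\<And>i. i \<in> gens w \<Longrightarrow> \<iota> i < n" for c w \<iota>
  proof -
    have "word_eval L (\<lambda>i. e (\<iota> i)) w \<in> carrier L"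
      using that e by (intro L.word_eval_closed) auto
    moreover have "\<pi> (word_eval L (\<lambda>i. e (\<iota> i)) w) = word_eval ?N (\<lambda>i. \<pi> (e (\<iota> i))) w"
      using that e by (intro \<pi>_word) simp
    moreover have "\<dots> = word_eval ?N (\<lambda>i. nilp_class m s (p (\<iota> i))) w"
      using that by (intro word_cong) (simp add: p(2))
    ultimately show ?thesis
      using coeff_form_word_eval[OF that(1), of "\<lambda>i. p (\<iota> i)" m c] that p by (simp add: F_def)
  qed
  have s1: "1 \<le> s"
    using ms by auto
  have "r j = 0" if r: "\<forall>i<n. (\<Sum>j<m. p i (Gen j) * r j) = 0" and j: "j < m" for r j
  proof -
    let ?F = "F (\<lambda>j k. r j) 1"
    have "?F (e i) = (\<zero>\<^bsub>dual_space L\<^esub>) (e i)" if "i < n" for i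
      using F_word[of "Gen 0" "\<lambda>_. i" "\<lambda>j k. r j"] s1 r that e L.zero_form by simp
    then have F0: "?F = \<zero>\<^bsub>dual_space L\<^esub>"
      using F[OF s1] L.zero_form by (intro L.form_eq_on_basis[OF b]) auto
    let ?g = "\<lambda>w. of_bool (w = Gen j) :: real"
    have g: "?g \<in> carrier ?A"
      using j by (auto simp: free_nonassoc_def)
    then obtain x where x: "x \<in> carrier L" "\<pi> x = nilp_class m s ?g"
      using onto nilp_class_image[of m s] by (metis (no_types, lifting) image_iff)
    have "?F x = (\<Sum>l<m. ?g (Gen l) * r l)"
      using x coeff_form_word_eval[of "Gen 0" s "\<lambda>_. ?g" m "\<lambda>j k. r j"] g s1 by (simp add: F_def)
    also have "\<dots> = (\<Sum>l<m. if l = j then r j else 0)"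
      by (intro sum.cong) auto
    also have "\<dots> = r j"
      using j by simp
    finally show "r j = 0"
      using F0 x L.zero_form by simp
  qed
  note span = this
  define K where "K = (if m = 2 then 2 else 3 :: nat)"
  have "K \<le> m"
    using ms by (auto simp: K_def)
  then have "\<exists>\<iota> a. (\<forall>i<K. \<iota> i < n) \<and>
      (\<forall>i<K. \<forall>q<K. (\<Sum>j<m. p (\<iota> i) (Gen j) * a q j) = of_bool (i = q))"
    by (rule dual_system_exists[rotated]) (rule span)
  then obtain \<iota> a where \<iota>: "\<And>i. i < K \<Longrightarrow> \<iota> i < n"
    and a: "\<And>i q. \<lbrakk>i < K; q < K\<rbrakk> \<Longrightarrow> (\<Sum>j<m. p (\<iota> i) (Gen j) * a q j) = of_bool (i = q)"
    by blast
  have coeff: "F (\<lambda>j k. a (W k) j) (word_degree w) (word_eval L (\<lambda>i. e (\<iota> i)) w) =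
      lie_weight (\<lambda>i k. of_bool (i = W k)) w 0"
    if "word_degree w \<le> s" "gens w \<subseteq> {..<K}" "\<And>k. W k < K" for w W
  proof -
    have "\<And>i. i \<in> gens w \<Longrightarrow> i < K"
      using that(2) by auto
    then show ?thesis
      using that \<iota> a by (subst F_word) (auto intro!: lie_weight_cong)
  qed
  have contra: False
    if w: "gens x \<subseteq> {..<K}" "gens y \<subseteq> {..<K}" "gens z \<subseteq> {..<K}"
      "word_degree x + word_degree y + word_degree z \<le> s"
      and W: "\<And>k. W k < K" "\<And>k. W' k < K"
      "lie_weight (\<lambda>i k. of_bool (i = W k)) (Br x (Br y z)) 0 = 0"
      "lie_weight (\<lambda>i k. of_bool (i = W k)) (Br y (Br z x)) 0 \<noteq> 0"
      "lie_weight (\<lambda>i k. of_bool (i = W' k)) (Br x (Br y z)) 0 \<noteq> 0"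
    for x y z W W'
  proof -
    let ?d = "word_degree (Br x (Br y z))" and ?ev = "word_eval L (\<lambda>i. e (\<iota> i))"
    have mult: "\<exists>i<n. \<exists>c. ?ev w = c \<odot>\<^bsub>L\<^esub> e i" if "gens w \<subseteq> {..<K}" for w
      using that \<iota> by (intro L.nice_basis_word_eval_multiple[OF ne]) auto
    have d: "?d \<le> s" "word_degree (Br y (Br z x)) = ?d"
      using w(4) by auto
    have "?ev x \<otimes>\<^bsub>L\<^esub> (?ev y \<otimes>\<^bsub>L\<^esub> ?ev z) = \<zero>\<^bsub>L\<^esub>"
    proof (rule L.nice_basis_jacobi_terms[OF ne mult mult mult F])
      show "F (\<lambda>j k. a (W k) j) ?d (?ev x \<otimes>\<^bsub>L\<^esub> (?ev y \<otimes>\<^bsub>L\<^esub> ?ev z)) = 0"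
        using coeff[of "Br x (Br y z)" W] w W d by simp
      show "F (\<lambda>j k. a (W k) j) ?d (?ev y \<otimes>\<^bsub>L\<^esub> (?ev z \<otimes>\<^bsub>L\<^esub> ?ev x)) \<noteq> 0"
        using coeff[of "Br y (Br z x)" W] w W d by (simp add: add.commute add.left_commute)
    qed (use w d in auto)
    then have "F (\<lambda>j k. a (W' k) j) ?d (?ev (Br x (Br y z))) = 0"
      using L.form_zero[OF F[OF d(1)]] by simp
    then show False
      using coeff[of "Br x (Br y z)" W'] w W d by simp
  qed
  show False
  proof (cases "m = 2")
    case True
    then have "K = 2" "s \<ge> 5"
      using ms by (auto simp: K_def)
    define mon where "mon l k = (if k < length l then l ! k else 0)" for l :: "nat list" and k :: nat
    (* With B = [x, [x, y]], the monomial xyxxy occurs in [y, [B, x]] but not in [x, [y, B]],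
       in which xyxyx occurs. *)
    show False
      by (rule contra[of "Gen 0" "Gen 1" "Br (Gen 0) (Br (Gen 0) (Gen 1))"
          "mon [0, 1, 0, 0, 1]" "mon [0, 1, 0, 1, 0]"])
        (use \<open>K = 2\<close> \<open>s \<ge> 5\<close> in \<open>auto simp: mon_def nth_Cons'\<close>)
  next
    case False
    then have "K = 3" "s \<ge> 3"
      using ms by (auto simp: K_def)
    define mon where "mon l k = (if k < length l then l ! k else 0)" for l :: "nat list" and k :: nat
    (* The monomial yxz occurs in [y, [z, x]] but not in [x, [y, z]], in which xyz occurs. *)
    show False
      by (rule contra[of "Gen 0" "Gen 1" "Gen 2" "mon [1, 0, 2]" "mon [0, 1, 2]"])
        (use \<open>K = 3\<close> \<open>s \<ge> 3\<close> in \<open>auto simp: mon_def nth_Cons'\<close>)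
  qed
qed

section \<open>Free nilpotent Lie algebras with one-dimensional multidegrees\<close>

fun word_count :: "word \<Rightarrow> nat \<Rightarrow> nat" where
  "word_count (Gen i) = (\<lambda>j. of_bool (j = i))"
| "word_count (Br u v) = (\<lambda>j. word_count u j + word_count v j)"

definition indicator_word :: "word \<Rightarrow> word \<Rightarrow> real" where
  "indicator_word w = (\<lambda>v. of_bool (v = w))"

definition word_class :: "nat \<Rightarrow> nat \<Rightarrow> word \<Rightarrow> (word \<Rightarrow> real) set set" where
  "word_class m s w = nilp_class m s (indicator_word w)"

lemma indicator_word_carrier:
  "gens w \<subseteq> {..<m} \<Longrightarrow> indicator_word w \<in> carrier (free_nonassoc m)"
  by (auto simp: indicator_word_def free_nonassoc_def)

lemma word_class_carrier:
  "gens w \<subseteq> {..<m} \<Longrightarrow> word_class m s w \<in> carrier (free_nilpotent m s)"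
  by (simp add: word_class_def nilp_class_image indicator_word_carrier)

lemma word_class_Br:
  assumes "gens u \<subseteq> {..<m}" "gens v \<subseteq> {..<m}"
  shows "word_class m s (Br u v) = word_class m s u \<otimes>\<^bsub>free_nilpotent m s\<^esub> word_class m s v"
proof -
  have "indicator_word (Br u v) = indicator_word u \<otimes>\<^bsub>free_nonassoc m\<^esub> indicator_word v"
    by (auto simp: indicator_word_def free_nonassoc_def fun_eq_iff split: word.split)
  then show ?thesis
    using assms by (simp add: word_class_def nilp_class_ops indicator_word_carrier)
qed

lemma word_class_eq_zero:
  assumes "gens w \<subseteq> {..<m}" "word_degree w > s"
  shows "word_class m s w = \<zero>\<^bsub>free_nilpotent m s\<^esub>"
proof -
  let ?A = "free_nonassoc m" and ?p = "indicator_word w"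
  interpret A: nonassoc_algebra ?A by (rule nonassoc_algebra_free_nonassoc)
  have p: "?p \<in> carrier ?A"
    using assms(1) by (rule indicator_word_carrier)
  have "submodule (lie_ideal m) real_ring ?A"
    using lie_ideal_facts(1)[of m] by (simp add: alg_ideal_def)
  then have "\<zero>\<^bsub>?A\<^esub> \<in> lie_ideal m"
    using subgroup.one_closed[OF submodule.axioms(1), of "lie_ideal m" real_ring ?A] by simp
  then have "?p \<ominus>\<^bsub>?A\<^esub> ?p \<in> lie_ideal m"
    using p by (simp add: a_minus_def A.r_neg)
  moreover have "\<forall>v. ?p v \<noteq> 0 \<longrightarrow> word_degree v > s"
    using assms(2) by (simp add: indicator_word_def)
  ultimately show ?thesis
    unfolding word_class_def nilp_class_eq_zero_iff[OF p] using p by blast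
qed

lemma coeff_form_word_class:
  assumes "d \<le> s" "gens w \<subseteq> {..<m}"
  shows "coeff_form m s c d (word_class m s w) =
    (if word_degree w = d then lie_weight c w 0 else 0)"
proof -
  have "coeff_form m s c d (word_class m s w) =
      shift_op c (indicator_word w) (\<lambda>k. of_bool (k = d)) 0"
    using assms by (simp add: word_class_def coeff_form_class indicator_word_carrier)
  also have "\<dots> = (\<Sum>v\<in>{w}. indicator_word w v * lie_weight c v 0 * of_bool (0 + word_degree v = d))"
    by (rule shift_op_superset) (auto simp: indicator_word_def)
  finally show ?thesis
    by (simp add: indicator_word_def)
qed

lemma free_nonassoc_induct:
  assumes p: "p \<in> carrier (free_nonassoc m)"
    and word: "\<And>w. gens w \<subseteq> {..<m} \<Longrightarrow> P (indicator_word w)"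
    and zero: "P \<zero>\<^bsub>free_nonassoc m\<^esub>"
    and add: "\<And>p q. \<lbrakk>p \<in> carrier (free_nonassoc m); q \<in> carrier (free_nonassoc m); P p; P q\<rbrakk> \<Longrightarrow>
      P (p \<oplus>\<^bsub>free_nonassoc m\<^esub> q)"
    and smult: "\<And>a p. \<lbrakk>p \<in> carrier (free_nonassoc m); P p\<rbrakk> \<Longrightarrow> P (a \<odot>\<^bsub>free_nonassoc m\<^esub> p)"
  shows "P p"
proof -
  interpret A: plain_algebra "free_nonassoc m"
    by (rule plain_algebra.intro) (rule nonassoc_algebra_free_nonassoc)
  have "P p" if "finite S" "p \<in> carrier (free_nonassoc m)" "{w. p w \<noteq> 0} \<subseteq> S" for S p
    using that
  proof (induction S arbitrary: p)
    case empty
    then have "p = \<zero>\<^bsub>free_nonassoc m\<^esub>"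
      by (auto simp: free_nonassoc_def)
    then show ?case using zero by simp
  next
    case (insert w S)
    show ?case
    proof (cases "p w = 0")
      case True
      with insert.prems have "{w. p w \<noteq> 0} \<subseteq> S"
        by auto
      with insert show ?thesis by blast
    next
      case False
      with insert.prems have w: "gens w \<subseteq> {..<m}"
        by (simp add: free_nonassoc_def)
      let ?q = "p(w := 0)"
      have q: "?q \<in> carrier (free_nonassoc m)"
        using insert.prems(1) by (auto simp: free_nonassoc_def elim: finite_subset[rotated])
      have "{v. ?q v \<noteq> 0} \<subseteq> S"
        using insert.prems(2) by auto
      then have "P ?q"
        using insert.IH q by blast
      moreover have "p = ?q \<oplus>\<^bsub>free_nonassoc m\<^esub> p w \<odot>\<^bsub>free_nonassoc m\<^esub> indicator_word w"
        by (auto simp: free_nonassoc_def indicator_word_def)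
      ultimately show ?thesis
        using add[OF q, of "p w \<odot>\<^bsub>free_nonassoc m\<^esub> indicator_word w"]
          smult[OF indicator_word_carrier[OF w] word[OF w]] indicator_word_carrier[OF w]
          A.smult_in_carrier by simp
    qed
  qed
  then show ?thesis
    using p carrier_finite by blast
qed

text \<open>A linear span that contains the generators and is closed under brackets is everything.\<close>

lemma word_classes_span:
  assumes h: "\<And>i. i < n \<Longrightarrow> gens (h i) \<subseteq> {..<m}"
    and gen: "\<And>j. j < m \<Longrightarrow> Gen j \<in> h ` {..<n}"
    and br: "\<And>i j. \<lbrakk>i < n; j < n\<rbrakk> \<Longrightarrow>
      \<exists>k<n. \<exists>c. word_class m s (Br (h i) (h j)) = c \<odot>\<^bsub>free_nilpotent m s\<^esub> word_class m s (h k)"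
    and x: "x \<in> carrier (free_nilpotent m s)"
  shows "\<exists>c. x = lin_comb (free_nilpotent m s) n (\<lambda>i. word_class m s (h i)) c"
proof -
  let ?N = "free_nilpotent m s" and ?e = "\<lambda>i. word_class m s (h i)"
  interpret N: plain_lie_algebra ?N
    by (rule plain_lie_algebra.intro) (rule lie_algebra_free_nilpotent)
  define S where "S = range (lin_comb ?N n ?e)"
  have e: "?e i \<in> carrier ?N" if "i < n" for i
    using h[OF that] by (rule word_class_carrier)
  have S_carrier: "y \<in> carrier ?N" if "y \<in> S" for y
    using that N.lin_comb_closed[of n ?e] e by (auto simp: S_def)
  have S_add: "y \<oplus>\<^bsub>?N\<^esub> z \<in> S" if "y \<in> S" "z \<in> S" for y z
    using that N.lin_comb_add[of n ?e] e by (auto simp: S_def)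
  have S_smult: "a \<odot>\<^bsub>?N\<^esub> y \<in> S" if "y \<in> S" for a y
    using that N.lin_comb_smult[of n ?e] e by (auto simp: S_def)
  have S_e: "?e i \<in> S" if "i < n" for i
    using N.basis_vector_lin_comb[of n ?e i] e that unfolding S_def by blast
  have S_0: "\<zero>\<^bsub>?N\<^esub> \<in> S"
    using N.lin_comb_zero[of n ?e "\<lambda>_. 0"] e unfolding S_def by (metis rangeI)
  have S_br1: "?e i \<otimes>\<^bsub>?N\<^esub> z \<in> S" if i: "i < n" and z: "z \<in> S" for i z
  proof -
    obtain c where "z = lin_comb ?N n ?e c"
      using z by (auto simp: S_def)
    moreover have "?e i \<otimes>\<^bsub>?N\<^esub> lin_comb ?N n ?e c \<in> S"
    proof (rule N.lin_comb_induct)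
      show "?e i \<otimes>\<^bsub>?N\<^esub> ?e j \<in> S" if "j < n" for j
      proof -
        obtain k a where k: "k < n" "word_class m s (Br (h i) (h j)) = a \<odot>\<^bsub>?N\<^esub> ?e k"
          using br[OF i \<open>j < n\<close>] by blast
        have "?e i \<otimes>\<^bsub>?N\<^esub> ?e j = word_class m s (Br (h i) (h j))"
          using h \<open>i < n\<close> \<open>j < n\<close> by (intro word_class_Br[symmetric])
        then show ?thesis
          using S_smult[OF S_e[OF k(1)]] k(2) by simp
      qed
    qed (use e i S_0 S_add S_smult in
        \<open>auto simp: N.bracket_zero N.prod_add_right N.prod_smult_right\<close>)
    ultimately show ?thesis by simp
  qed
  have S_br: "y \<otimes>\<^bsub>?N\<^esub> z \<in> S" if y: "y \<in> S" and z: "z \<in> S" for y z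
  proof -
    obtain c where "y = lin_comb ?N n ?e c"
      using y by (auto simp: S_def)
    moreover have "lin_comb ?N n ?e c \<otimes>\<^bsub>?N\<^esub> z \<in> S"
      by (rule N.lin_comb_induct) (use e z S_0 S_add S_smult S_br1 S_carrier in
        \<open>auto simp: N.bracket_zero N.prod_add_left N.prod_smult_left\<close>)
    ultimately show ?thesis by simp
  qed
  have S_word: "word_class m s w \<in> S" if "gens w \<subseteq> {..<m}" for w
    using that
  proof (induction w)
    case (Gen j)
    then obtain i where "i < n" "Gen j = h i"
      using gen[of j] by auto
    then show ?case
      using S_e by simp
  next
    case (Br u v)
    then show ?case
      by (simp add: word_class_Br S_br)
  qed
  obtain p where p: "p \<in> carrier (free_nonassoc m)" "x = nilp_class m s p"
    using x unfolding nilp_class_image by (rule imageE)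
  have zero: "nilp_class m s \<zero>\<^bsub>free_nonassoc m\<^esub> = \<zero>\<^bsub>?N\<^esub>"
  proof -
    interpret A: plain_algebra "free_nonassoc m"
      by (rule plain_algebra.intro) (rule nonassoc_algebra_free_nonassoc)
    show ?thesis
      using nilp_class_ops(3)[OF A.zero_closed A.zero_closed, of s 0]
      by (simp add: A.zero_smult N.zero_smult nilp_class_image)
  qed
  have "nilp_class m s p \<in> S"
    using p(1)
  proof (rule free_nonassoc_induct)
    show "nilp_class m s (indicator_word w) \<in> S" if "gens w \<subseteq> {..<m}" for w
      using S_word[OF that] by (simp add: word_class_def)
  qed (simp_all add: nilp_class_ops zero S_0 S_add S_smult)
  then show ?thesis
    using p by (auto simp: S_def)
qed

text \<open>
  A bracket distributes the positions of a monomial over its two halves, so by induction a monomial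
  in the expansion of a word has the letters of this word.
\<close>

lemma word_count_monomial:
  assumes "lie_weight (\<lambda>i k. of_bool (i = W k)) w n \<noteq> 0"
  shows "word_count w i = card {k \<in> {n..<n + word_degree w}. W k = i}"
  using assms
proof (induction w arbitrary: n)
  case (Gen j)
  have "{k \<in> {n..<n + 1}. W k = i} = (if W n = i then {n} else {})"
    by auto
  then show ?case
    using Gen by simp
next
  case (Br u v)
  have split: "card {k \<in> {n..<n + (a + b)}. W k = i} =
      card {k \<in> {n..<n + a}. W k = i} + card {k \<in> {n + a..<n + a + b}. W k = i}" for a b
    by (subst card_Un_disjoint[symmetric]) (auto intro!: arg_cong[where f = card])
  consider "lie_weight (\<lambda>i k. of_bool (i = W k)) u n \<noteq> 0"
      "lie_weight (\<lambda>i k. of_bool (i = W k)) v (n + word_degree u) \<noteq> 0"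
    | "lie_weight (\<lambda>i k. of_bool (i = W k)) v n \<noteq> 0"
      "lie_weight (\<lambda>i k. of_bool (i = W k)) u (n + word_degree v) \<noteq> 0"
    using Br.prems by fastforce
  then show ?case
  proof cases
    case 1
    then show ?thesis
      using Br.IH split[of "word_degree u" "word_degree v"] by simp
  next
    case 2
    then show ?thesis
      using Br.IH split[of "word_degree v" "word_degree u"] by (simp add: add.commute)
  qed
qed

text \<open>
  If words with pairwise distinct multidegrees span, then each of their brackets can only be a
  multiple of the word in the sum of the two multidegrees, and two of the three multidegrees
  determine the third.
\<close>

theorem nice_if_distinct_multidegrees:
  assumes fin: "finite J" and "m > 0"
    and J: "\<And>w. w \<in> J \<Longrightarrow> gens w \<subseteq> {..<m} \<and> word_degree w \<le> s"
    and gen: "\<And>i. i < m \<Longrightarrow> Gen i \<in> J"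
    and inj: "inj_on word_count J"
    and nz: "\<And>w. w \<in> J \<Longrightarrow> \<exists>W. lie_weight (\<lambda>i k. of_bool (i = W k)) w 0 \<noteq> 0"
    and br: "\<And>u v. \<lbrakk>u \<in> J; v \<in> J; word_degree u \<le> word_degree v; word_degree u + word_degree v \<le> s\<rbrakk> \<Longrightarrow>
      \<exists>w\<in>J. \<exists>c. word_class m s (Br u v) = c \<odot>\<^bsub>free_nilpotent m s\<^esub> word_class m s w"
  shows "nice (free_nilpotent m s)"
proof -
  let ?N = "free_nilpotent m s"
  interpret N: plain_lie_algebra ?N
    by (rule plain_lie_algebra.intro) (rule lie_algebra_free_nilpotent)
  have br': "\<exists>w\<in>J. \<exists>c. word_class m s (Br u v) = c \<odot>\<^bsub>?N\<^esub> word_class m s w"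
    if uv: "u \<in> J" "v \<in> J" for u v
  proof -
    have g: "gens u \<subseteq> {..<m}" "gens v \<subseteq> {..<m}"
      using J uv by auto
    note cl = word_class_carrier[of _ m s]
    consider "word_degree u + word_degree v > s"
      | "word_degree u + word_degree v \<le> s" "word_degree u \<le> word_degree v"
      | "word_degree u + word_degree v \<le> s" "word_degree v \<le> word_degree u"
      by linarith
    then show ?thesis
    proof cases
      case 1
      then have "word_class m s (Br u v) = 0 \<odot>\<^bsub>?N\<^esub> word_class m s u"
        using g word_class_eq_zero[of "Br u v" m s] cl N.zero_smult by simp
      then show ?thesis using uv by blast
    next
      case 2
      then show ?thesis using br uv by blast
    next
      case 3
      then obtain w c where w: "w \<in> J" "word_class m s (Br v u) = c \<odot>\<^bsub>?N\<^esub> word_class m s w"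
        using br[of v u] uv by (auto simp: add.commute)
      have "word_class m s (Br u v) = (-1) \<odot>\<^bsub>?N\<^esub> (c \<odot>\<^bsub>?N\<^esub> word_class m s w)"
        using g cl N.bracket_antisym[of "word_class m s v" "word_class m s u"] w(2)
        by (simp add: word_class_Br)
      also have "\<dots> = (-1 * c) \<odot>\<^bsub>?N\<^esub> word_class m s w"
        using N.smult_assoc1[of "-1" c "word_class m s w"] cl J w(1) by simp
      finally show ?thesis using w(1) by blast
    qed
  qed
  obtain mono where mono: "\<And>w. w \<in> J \<Longrightarrow> lie_weight (\<lambda>i k. of_bool (i = mono w k)) w 0 \<noteq> 0"
    using nz by metis
  define l where "l v w = lie_weight (\<lambda>i k. of_bool (i = mono v k)) w 0" for v w
  define \<eta> where "\<eta> v = (1 / l v v) \<odot>\<^bsub>dual_space ?N\<^esub>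
    coeff_form m s (\<lambda>i k. of_bool (i = mono v k)) (word_degree v)" for v
  have \<eta>_dual: "\<eta> v \<in> carrier (dual_space ?N)" if "v \<in> J" for v
    unfolding \<eta>_def using J[OF that] by (intro N.dual_smult_in_dual coeff_form_in_dual) auto
  have \<eta>: "\<eta> v (word_class m s w) = (if word_degree w = word_degree v then l v w / l v v else 0)"
    if "v \<in> J" "gens w \<subseteq> {..<m}" for v w
    using that J[OF that(1)] word_class_carrier[OF that(2), of s]
    by (simp add: \<eta>_def dual_space_def coeff_form_word_class l_def)
  have \<eta>_self: "\<eta> v (word_class m s v) = 1" if "v \<in> J" for v
    using that J mono[OF that] by (simp add: \<eta> l_def)
  have \<eta>_count: "word_count w = word_count v"
    if "v \<in> J" "gens w \<subseteq> {..<m}" "\<eta> v (word_class m s w) \<noteq> 0" for v w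
  proof -
    have "word_degree w = word_degree v" "l v w \<noteq> 0" "l v v \<noteq> 0"
      using that \<eta>[OF that(1,2)] by (auto split: if_splits)
    then show ?thesis
      using word_count_monomial[of "mono v" w 0] word_count_monomial[of "mono v" v 0]
      by (auto simp: l_def)
  qed
  obtain h where h: "bij_betw h {0..<card J} J"
    using ex_bij_betw_nat_finite[OF fin] by blast
  define n where "n = card J"
  have hJ: "h i \<in> J" if "i < n" for i
    using h that by (auto simp: bij_betw_def n_def)
  have h_inj: "i = j" if "h i = h j" "i < n" "j < n" for i j
    using h that by (auto simp: bij_betw_def n_def inj_on_def)
  have h_onto: "\<exists>i<n. w = h i" if "w \<in> J" for w
    using h that by (force simp: bij_betw_def n_def)
  have g: "gens (h i) \<subseteq> {..<m}" if "i < n" for i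
    using J hJ that by blast
  let ?e = "\<lambda>i. word_class m s (h i)"
  have e: "?e i \<in> carrier ?N" if "i < n" for i
    using g that by (intro word_class_carrier)
  have d: "dual_basis ?N n ?e (\<lambda>i. \<eta> (h i))"
    unfolding dual_basis_def
  proof (intro conjI allI impI)
    fix i j
    assume ij: "i < n" "j < n"
    show "\<eta> (h j) (?e i) = (if i = j then 1 else 0)"
    proof (cases "i = j")
      case False
      then have "word_count (h i) \<noteq> word_count (h j)"
        using inj hJ ij h_inj by (metis inj_on_def)
      then show ?thesis
        using \<eta>_count[OF hJ[OF ij(2)] g[OF ij(1)]] False by auto
    qed (use \<eta>_self hJ ij in simp)
  qed (use \<eta>_dual hJ in blast)
  have T: "word_count (h k) = (\<lambda>p. word_count (h i) p + word_count (h j) p)"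
    if "i < n" "j < n" "k < n" "\<eta> (h k) (?e i \<otimes>\<^bsub>?N\<^esub> ?e j) \<noteq> 0" for i j k
    using \<eta>_count[of "h k" "Br (h i) (h j)"] that hJ g by (simp add: word_class_Br)
  have "nice_basis ?N n ?e"
  proof (rule N.nice_basisI[OF e d])
    fix x
    assume x: "x \<in> carrier ?N" "\<And>i. i < n \<Longrightarrow> \<eta> (h i) x = 0"
    have "\<exists>c. x = lin_comb ?N n ?e c"
    proof (rule word_classes_span[OF g _ _ x(1)])
      show "Gen j \<in> h ` {..<n}" if "j < m" for j
        using h_onto[OF gen[OF that]] by blast
      show "\<exists>k<n. \<exists>c. word_class m s (Br (h i) (h j)) = c \<odot>\<^bsub>?N\<^esub> word_class m s (h k)"
        if "i < n" "j < n" for i j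
        using br'[OF hJ[OF that(1)] hJ[OF that(2)]] h_onto by blast
    qed
    then obtain c where c: "x = lin_comb ?N n ?e c" ..
    have "c i = 0" if "i < n" for i
      using N.form_lin_comb_dual_basis[OF d e that] x(2)[OF that] by (simp add: c)
    then show "x = \<zero>\<^bsub>?N\<^esub>"
      unfolding c using e by (intro N.lin_comb_zero)
  next
    fix i j k k'
    assume "i < n" "j < n" "k < n" "k' < n" "\<eta> (h k) (?e i \<otimes>\<^bsub>?N\<^esub> ?e j) \<noteq> 0"
      "\<eta> (h k') (?e i \<otimes>\<^bsub>?N\<^esub> ?e j) \<noteq> 0"
    then have "word_count (h k) = word_count (h k')" "k < n" "k' < n"
      using T by simp_all
    then show "k = k'"
      using inj hJ h_inj by (metis inj_onD)
  next
    fix i j j' k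
    assume a: "i < n" "j < n" "j' < n" "k < n" "\<eta> (h k) (?e i \<otimes>\<^bsub>?N\<^esub> ?e j) \<noteq> 0"
      "\<eta> (h k) (?e i \<otimes>\<^bsub>?N\<^esub> ?e j') \<noteq> 0"
    have "word_count (h j) p = word_count (h j') p" for p
      using T[OF a(1,2,4,5)] T[OF a(1,3,4,6)] by (metis add_left_cancel)
    then show "j = j'"
      using inj hJ h_inj a by (metis inj_onD ext)
  qed
  then show ?thesis
    by (auto simp: nice_def)
qed

lemma word_class_bracket_self:
  assumes "gens w \<subseteq> {..<m}"
  shows "word_class m s (Br w w) = 0 \<odot>\<^bsub>free_nilpotent m s\<^esub> word_class m s w"
proof -
  interpret N: plain_lie_algebra "free_nilpotent m s"
    by (rule plain_lie_algebra.intro) (rule lie_algebra_free_nilpotent)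
  show ?thesis
    using word_class_carrier[OF assms, of s] assms
    by (simp add: word_class_Br N.bracket_self N.zero_smult)
qed

lemma word_class_bracket_swap:
  assumes "gens u \<subseteq> {..<m}" "gens v \<subseteq> {..<m}"
  shows "word_class m s (Br v u) = (-1) \<odot>\<^bsub>free_nilpotent m s\<^esub> word_class m s (Br u v)"
proof -
  interpret N: plain_lie_algebra "free_nilpotent m s"
    by (rule plain_lie_algebra.intro) (rule lie_algebra_free_nilpotent)
  show ?thesis
    using N.bracket_antisym[OF word_class_carrier[OF assms(1)] word_class_carrier[OF assms(2)]] assms
    by (simp only: word_class_Br)
qed

lemma word_count_support: "gens w = {i. word_count w i \<noteq> 0}"
  by (induction w) auto

theorem nice_free_nilpotent_two_step:
  assumes "m \<ge> 2" "s \<ge> 1" "s \<le> 2"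
  shows "nice (free_nilpotent m s)"
proof -
  let ?N = "free_nilpotent m s"
  interpret N: plain_lie_algebra ?N
    by (rule plain_lie_algebra.intro) (rule lie_algebra_free_nilpotent)
  define H where "H = Gen ` {..<m} \<union> {Br (Gen i) (Gen j) | i j. i < j \<and> j < m}"
  define J where "J = {w \<in> H. word_degree w \<le> s}"
  have "finite {(i, j). i < j \<and> j < m}"
    by (rule finite_subset[of _ "{..<m} \<times> {..<m}"]) auto
  moreover have "{Br (Gen i) (Gen j) | i j. i < j \<and> j < m} =
      (\<lambda>(i, j). Br (Gen i) (Gen j)) ` {(i, j). i < j \<and> j < m}"
    by auto
  ultimately have fin: "finite H"
    by (simp add: H_def)
  have J_cases: "(\<exists>i<m. w = Gen i) \<or> (\<exists>i j. i < j \<and> j < m \<and> w = Br (Gen i) (Gen j) \<and> s = 2)"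
    if "w \<in> J" for w
    using that assms by (auto simp: J_def H_def)
  show ?thesis
  proof (rule nice_if_distinct_multidegrees[of J])
    show "finite J"
      using fin by (simp add: J_def)
    show "inj_on word_count J"
    proof (rule inj_onI)
      fix u v
      assume uv: "u \<in> J" "v \<in> J" and eq: "word_count u = word_count v"
      have "gens u = gens v"
        using word_count_support[of u] word_count_support[of v] eq by simp
      then show "u = v"
        using J_cases[OF uv(1)] J_cases[OF uv(2)] by (auto simp: doubleton_eq_iff)
    qed
    show "\<exists>W. lie_weight (\<lambda>i k. of_bool (i = W k)) w 0 \<noteq> 0" if "w \<in> J" for w
      using J_cases[OF that]
    proof (elim disjE exE conjE)
      fix i
      assume "w = Gen i"
      then show ?thesis by (intro exI[of _ "\<lambda>_. i"]) simp
    next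
      fix i j
      assume "w = Br (Gen i) (Gen j)" "i < j"
      then show ?thesis by (intro exI[of _ "\<lambda>k. if k = 0 then i else j"]) simp
    qed
    fix u v
    assume uv: "u \<in> J" "v \<in> J" "word_degree u \<le> word_degree v" "word_degree u + word_degree v \<le> s"
    have "s = 2" "word_degree u = 1" "word_degree v = 1"
      using uv(3,4) assms(3) word_degree_pos[of u] word_degree_pos[of v] by linarith+
    then obtain i j where ij: "u = Gen i" "v = Gen j" "i < m" "j < m" "s = 2"
      using J_cases[OF uv(1)] J_cases[OF uv(2)] by auto
    have mem: "Br (Gen i) (Gen j) \<in> J" if "i < j" "j < m" for i j
      using that ij by (auto simp: J_def H_def)
    consider "i = j" | "i < j" | "j < i"
      by linarith
    then show "\<exists>w\<in>J. \<exists>c. word_class m s (Br u v) = c \<odot>\<^bsub>?N\<^esub> word_class m s w"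
    proof cases
      case 1
      then show ?thesis
        using word_class_bracket_self[of u m s] uv(1) ij(1-3) by (intro bexI[of _ u] exI[of _ 0]) simp_all
    next
      case 2
      then have "word_class m s (Br u v) = 1 \<odot>\<^bsub>?N\<^esub> word_class m s (Br u v)"
        using ij N.smult_one[OF word_class_carrier[of "Br u v" m s]] by simp
      then show ?thesis
        using mem[OF 2] ij by blast
    next
      case 3
      then show ?thesis
        using mem[OF 3] ij(1-4) word_class_bracket_swap[of v m u s]
        by (intro bexI[of _ "Br v u"] exI[of _ "-1"]) simp_all
    qed
  qed (use assms in \<open>auto simp: J_def H_def\<close>)
qed

text \<open>
  On two generators the multidegrees up to degree 4 are simple because \<open>[x, [y, [x, y]]]\<close> and
  \<open>[y, [x, [x, y]]]\<close> coincide.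
\<close>

theorem nice_free_nilpotent_two_generators:
  assumes "s \<ge> 1" "s \<le> 4"
  shows "nice (free_nilpotent 2 s)"
proof -
  let ?N = "free_nilpotent 2 s"
  interpret N: plain_lie_algebra ?N
    by (rule plain_lie_algebra.intro) (rule lie_algebra_free_nilpotent)
  define x y a b c where "x = Gen 0" "y = Gen 1" and abc: "a = Br x y" "b = Br x a" "c = Br y a"
  note defs = this
  define H where "H = {x, y, a, b, c, Br x b, Br y b, Br y c}"
  define J where "J = {w \<in> H. word_degree w \<le> s}"
  have gens: "gens w \<subseteq> {..<2}" if "w \<in> H" for w
    using that by (auto simp: H_def defs)
  define mon where "mon l k = (if k < length l then l ! k else 0)" for l :: "nat list" and k :: nat
  have cl: "word_class 2 s w \<in> carrier ?N" if "gens w \<subseteq> {..<2}" for w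
    using that by (rule word_class_carrier)
  have H_cases: "w \<in> H \<Longrightarrow> w = x \<or> w = y \<or> w = a \<or> w = b \<or> w = c \<or> w = Br x b \<or> w = Br y b \<or> w = Br y c" for w
    by (simp add: H_def)
  have H_memb: "Br x y \<in> H" "Br x a \<in> H" "Br y a \<in> H" "Br x b \<in> H" "Br y b \<in> H" "Br y c \<in> H"
    by (simp_all add: H_def abc)
  have deg: "word_degree x = 1" "word_degree y = 1" "word_degree a = 2" "word_degree b = 3"
    "word_degree c = 3"
    by (simp_all add: defs)
  have count: "word_count x 0 = 1" "word_count x 1 = 0" "word_count y 0 = 0" "word_count y 1 = 1"
    "word_count a 0 = 1" "word_count a 1 = 1" "word_count b 0 = 2" "word_count b 1 = 1"
    "word_count c 0 = 1" "word_count c 1 = 2"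
    by (simp_all add: defs)
  have xc_yb: "word_class 2 s (Br x c) = word_class 2 s (Br y b)"
  proof -
    let ?w = "word_class 2 s"
    have g: "gens x \<subseteq> {..<2}" "gens y \<subseteq> {..<2}" "gens a \<subseteq> {..<2}"
      by (auto simp: defs)
    have X: "?w x \<in> carrier ?N" "?w y \<in> carrier ?N" "?w a \<in> carrier ?N"
      using g by (simp_all add: cl)
    have "?w x \<otimes>\<^bsub>?N\<^esub> (?w y \<otimes>\<^bsub>?N\<^esub> ?w a) \<oplus>\<^bsub>?N\<^esub> ?w y \<otimes>\<^bsub>?N\<^esub> (?w a \<otimes>\<^bsub>?N\<^esub> ?w x)
        \<oplus>\<^bsub>?N\<^esub> ?w a \<otimes>\<^bsub>?N\<^esub> (?w x \<otimes>\<^bsub>?N\<^esub> ?w y) = \<zero>\<^bsub>?N\<^esub>"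
      using X by (rule N.jacobi)
    moreover have "?w a \<otimes>\<^bsub>?N\<^esub> (?w x \<otimes>\<^bsub>?N\<^esub> ?w y) = \<zero>\<^bsub>?N\<^esub>"
    proof -
      have "?w x \<otimes>\<^bsub>?N\<^esub> ?w y = ?w a"
        using word_class_Br[OF g(1,2), of s] by (simp add: abc(1))
      then show ?thesis
        using X N.bracket_self by simp
    qed
    moreover have "?w y \<otimes>\<^bsub>?N\<^esub> (?w a \<otimes>\<^bsub>?N\<^esub> ?w x) = \<ominus>\<^bsub>?N\<^esub> (?w y \<otimes>\<^bsub>?N\<^esub> (?w x \<otimes>\<^bsub>?N\<^esub> ?w a))"
    proof -
      let ?t = "?w y \<otimes>\<^bsub>?N\<^esub> (?w x \<otimes>\<^bsub>?N\<^esub> ?w a)"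
      have t: "?t \<in> carrier ?N"
        using X by (simp add: N.prod_closed)
      have "?w y \<otimes>\<^bsub>?N\<^esub> (?w a \<otimes>\<^bsub>?N\<^esub> ?w x) = (-1) \<odot>\<^bsub>?N\<^esub> ?t"
        using X N.bracket_antisym[of "?w x" "?w a"] by (simp add: N.prod_smult_right N.prod_closed)
      moreover have "(-1) \<odot>\<^bsub>?N\<^esub> ?t \<oplus>\<^bsub>?N\<^esub> ?t = \<zero>\<^bsub>?N\<^esub>"
        using N.smult_l_distr[of "-1" 1 ?t] t N.smult_one N.zero_smult by simp
      ultimately show ?thesis
        using N.minus_equality[of "(-1) \<odot>\<^bsub>?N\<^esub> ?t" ?t] t by simp
    qed
    ultimately have "?w x \<otimes>\<^bsub>?N\<^esub> (?w y \<otimes>\<^bsub>?N\<^esub> ?w a) \<ominus>\<^bsub>?N\<^esub> ?w y \<otimes>\<^bsub>?N\<^esub> (?w x \<otimes>\<^bsub>?N\<^esub> ?w a) = \<zero>\<^bsub>?N\<^esub>"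
      using X by (simp add: N.prod_closed a_minus_def)
    then have "?w x \<otimes>\<^bsub>?N\<^esub> (?w y \<otimes>\<^bsub>?N\<^esub> ?w a) = ?w y \<otimes>\<^bsub>?N\<^esub> (?w x \<otimes>\<^bsub>?N\<^esub> ?w a)"
      by (rule N.minus_eq_zeroD) (use X in \<open>auto simp: N.prod_closed\<close>)
    then show ?thesis
      using g by (simp add: abc(2,3) word_class_Br)
  qed
  show ?thesis
  proof (rule nice_if_distinct_multidegrees[of J])
    show "inj_on word_count J"
    proof (rule inj_onI)
      fix u v
      assume "u \<in> J" "v \<in> J" and eq: "word_count u = word_count v"
      then have "u \<in> H" "v \<in> H"
        by (simp_all add: J_def)
      from this[THEN H_cases] fun_cong[OF eq, of 0] fun_cong[OF eq, of 1]
      show "u = v"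
        by (elim disjE) (simp_all add: count count[unfolded One_nat_def])
    qed
    show "\<exists>W. lie_weight (\<lambda>i k. of_bool (i = W k)) w 0 \<noteq> 0" if "w \<in> J" for w
    proof -
      have "\<exists>l. lie_weight (\<lambda>i k. of_bool (i = mon l k)) w 0 \<noteq> 0"
      proof -
        let ?nz = "\<lambda>l w. lie_weight (\<lambda>i k. of_bool (i = mon l k)) w 0 \<noteq> 0"
        have "?nz [0] x" "?nz [1] y" "?nz [0, 1] a" "?nz [0, 0, 1] b" "?nz [1, 1, 0] c"
          "?nz [0, 0, 0, 1] (Br x b)" "?nz [1, 1, 0, 0] (Br y b)" "?nz [1, 1, 1, 0] (Br y c)"
          by (simp_all add: defs mon_def nth_Cons')
        moreover have "w \<in> H"
          using that by (simp add: J_def)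
        ultimately show ?thesis
          unfolding H_def by blast
      qed
      then show ?thesis by blast
    qed
    fix u v
    assume uv: "u \<in> J" "v \<in> J" "word_degree u \<le> word_degree v" "word_degree u + word_degree v \<le> s"
    let ?ok = "\<lambda>u v. \<exists>w\<in>J. \<exists>c. word_class 2 s (Br u v) = c \<odot>\<^bsub>?N\<^esub> word_class 2 s w"
    have self: "?ok u v" if "u = v"
      using word_class_bracket_self[OF gens, of u s] uv(1) that
      by (intro bexI[of _ u] exI[of _ 0]) (simp_all add: J_def)
    have mem: "?ok u v" if "Br u v \<in> H"
    proof -
      have "Br u v \<in> J" "word_class 2 s (Br u v) = 1 \<odot>\<^bsub>?N\<^esub> word_class 2 s (Br u v)"
        using that uv N.smult_one[OF cl[OF gens[OF that]]] by (simp_all add: J_def)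
      then show ?thesis by blast
    qed
    have d: "word_degree u + word_degree v \<le> 4" "u \<in> H" "v \<in> H"
      using uv assms by (auto simp: J_def)
    have "u = v \<or> Br u v \<in> H \<or> (u = y \<and> v = x) \<or> (u = x \<and> v = c)"
      using H_cases[OF d(2)] H_cases[OF d(3)] d(1) uv(3)
      by (elim disjE) (simp_all add: deg H_memb)
    then show "?ok u v"
    proof (elim disjE conjE)
      assume e: "u = y" "v = x"
      then have "a \<in> J"
        using uv by (auto simp: J_def H_def defs)
      moreover have "word_class 2 s (Br u v) = (-1) \<odot>\<^bsub>?N\<^esub> word_class 2 s a"
        unfolding e abc by (rule word_class_bracket_swap) (auto simp: defs)
      ultimately show ?thesis by blast
    next
      assume e: "u = x" "v = c"
      then have yb: "Br y b \<in> J"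
        using uv by (auto simp: J_def H_def defs)
      then have "word_class 2 s (Br u v) = 1 \<odot>\<^bsub>?N\<^esub> word_class 2 s (Br y b)"
        using N.smult_one[OF cl[OF gens]] xc_yb e by (simp add: J_def)
      with yb show ?thesis by blast
    qed (use self mem in blast)+
  qed (use assms gens in \<open>auto simp: J_def H_def defs less_2_cases_iff\<close>)
qed

section \<open>The equivalence\<close>

theorem theorem3p11:
  fixes m s :: nat
  assumes "m \<ge> 2" and "s \<ge> 1"
  shows "(nonnice (free_nilpotent m s) \<longleftrightarrow> nonnice (cotangent (free_nilpotent m s))) \<and>
         (nonnice (cotangent (free_nilpotent m s)) \<longleftrightarrow>
            (m = 2 \<and> s \<ge> 5) \<or> (m \<ge> 3 \<and> s \<ge> 3))"
proof -
  let ?N = "free_nilpotent m s"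
  have N: "lie_algebra ?N"
    by (rule lie_algebra_free_nilpotent)
  interpret N: plain_lie_algebra ?N
    by (rule plain_lie_algebra.intro[OF N])
  have cot: "nonnice ?N" if "nonnice (cotangent ?N)"
    using that nice_cotangent[OF N] by (auto simp: nonnice_def)
  show ?thesis
  proof (cases "(m = 2 \<and> s \<ge> 5) \<or> (m \<ge> 3 \<and> s \<ge> 3)")
    case True
    have "fst ` carrier (cotangent ?N) = carrier ?N"
      using N.zero_form(1) by (auto simp: cotangent_ops image_iff)
    then have "nonnice (cotangent ?N)"
      by (intro nonnice_if_onto_free_nilpotent[where \<pi> = fst, OF lie_algebra_cotangent[OF N] _ _ _ _ True])
        (simp_all add: cotangent_ops)
    with True cot show ?thesis by blast
  next
    case False
    have "nice ?N"
    proof (cases "s \<le> 2")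
      case True
      then show ?thesis
        using assms by (intro nice_free_nilpotent_two_step)
    next
      case False
      with \<open>\<not> (m = 2 \<and> s \<ge> 5 \<or> m \<ge> 3 \<and> s \<ge> 3)\<close> assms have "m = 2" "s \<le> 4"
        by auto
      then show ?thesis
        using assms nice_free_nilpotent_two_generators by simp
    qed
    then show ?thesis
      using False nice_cotangent[OF N] by (simp add: nonnice_def)
  qed
qed

end
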